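(* Let $\alpha\in(0,1)$. (I) Suppose $F\in\mathbb{P}(\mathbb{Z}^+)$ is aperiodic and there exist $\varepsilon\in(0,1)$ and $c>0$ such that $1-\mathrm{Re}\,\widehat{F}(\xi)\ge\varepsilon|\xi|^{\alpha}$ for all $\xi\in[-\varepsilon,\varepsilon]$, and $|\partial_\xi\widehat{F}(\xi)|\le c|\xi|^{\alpha-1}$ for all $\xi\in[-\pi,\pi]\setminus\{0\}$. Then $F\in\mathcal{A}$. (II) Let $F,G\in\mathbb{P}(\mathbb{Z}^+)$ be aperiodic, with $F$ satisfying the hypotheses of part (I) (for this $\alpha$). If there exists $a>0$ such that $\sum_{k\ge1}k|G(k)-aF(k)|<\infty$, then $G$ also satisfies the hypotheses of part (I) (for this $\alpha$, with suitable constants $\varepsilon,c$), and hence $G\in\mathcal{A}$.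
   Context: $\mathbb{P}(\mathbb{Z}^+)$ is the set of functions $F:\mathbb{Z}\to[0,1]$ with $\sum_kF(k)=1$ and $F(k)=0$ for $k<0$. $\widehat{F}(\xi)=\sum_kF(k)e^{-ik\xi}$ for $\xi\in[-\pi,\pi]$; $\partial_\xi$ denotes derivative in $\xi$. $F$ is adapted if $\mathrm{supp}(F)$ generates the group $\mathbb{Z}$, and aperiodic if every translate $\delta_m*F$, $m\in\mathbb{Z}$, is adapted ($\delta_m$ the point mass at $m$). $F^{(n)}$ is the $n$-th convolution power, and $\mathcal{A}=\{F\in\mathbb{P}(\mathbb{Z}^+):\sup_{n\in\mathbb{N}}n\sum_k|F^{(n)}(k)-F^{(n+1)}(k)|<\infty\}$. *)

theory Defs
  imports "HOL-Analysis.Analysis"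
begin

definition prob_Zplus :: "(int \<Rightarrow> real) \<Rightarrow> bool" where
  "prob_Zplus F \<longleftrightarrow> (\<forall>k. 0 \<le> F k \<and> F k \<le> 1) \<and> (F has_sum 1) UNIV \<and> (\<forall>k<0. F k = 0)"

definition fourier :: "(int \<Rightarrow> real) \<Rightarrow> real \<Rightarrow> complex" where
  "fourier F \<xi> = (\<Sum>\<^sub>\<infinity>k. complex_of_real (F k) * exp (- \<i> * of_int k * of_real \<xi>))"

definition supp :: "(int \<Rightarrow> real) \<Rightarrow> int set" where
  "supp F = {k. F k \<noteq> 0}"

definition int_subgroup :: "int set \<Rightarrow> bool" where
  "int_subgroup H \<longleftrightarrow> 0 \<in> H \<and> (\<forall>x\<in>H. \<forall>y\<in>H. x - y \<in> H)"

definition gen_subgroup :: "int set \<Rightarrow> int set" where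
  "gen_subgroup S = \<Inter>{H. int_subgroup H \<and> S \<subseteq> H}"

definition adapted :: "(int \<Rightarrow> real) \<Rightarrow> bool" where
  "adapted F \<longleftrightarrow> gen_subgroup (supp F) = UNIV"

definition delta :: "int \<Rightarrow> int \<Rightarrow> real" where
  "delta m k = (if k = m then 1 else 0)"

definition conv :: "(int \<Rightarrow> real) \<Rightarrow> (int \<Rightarrow> real) \<Rightarrow> int \<Rightarrow> real" where
  "conv F G k = (\<Sum>\<^sub>\<infinity>j. F j * G (k - j))"

definition aperiodic :: "(int \<Rightarrow> real) \<Rightarrow> bool" where
  "aperiodic F \<longleftrightarrow> (\<forall>m. adapted (conv (delta m) F))"

fun convpow :: "(int \<Rightarrow> real) \<Rightarrow> nat \<Rightarrow> int \<Rightarrow> real" where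
  "convpow F 0 = delta 0"
| "convpow F (Suc n) = conv F (convpow F n)"

definition classA :: "(int \<Rightarrow> real) set" where
  "classA = {F. prob_Zplus F \<and>
     (\<forall>n::nat. (\<lambda>k. \<bar>convpow F n k - convpow F (Suc n) k\<bar>) summable_on UNIV) \<and>
     bdd_above (range (\<lambda>n::nat. real n * (\<Sum>\<^sub>\<infinity>k. \<bar>convpow F n k - convpow F (Suc n) k\<bar>)))}"

definition hypI :: "real \<Rightarrow> (int \<Rightarrow> real) \<Rightarrow> bool" where
  "hypI \<alpha> F \<longleftrightarrow> prob_Zplus F \<and> aperiodic F \<and>
     (\<exists>\<epsilon> c. 0 < \<epsilon> \<and> \<epsilon> < 1 \<and> 0 < c \<and>
        (\<forall>\<xi>\<in>{-\<epsilon>..\<epsilon>}. 1 - Re (fourier F \<xi>) \<ge> \<epsilon> * \<bar>\<xi>\<bar> powr \<alpha>) \<and>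
        (\<forall>\<xi>\<in>{-pi..pi} - {0}. fourier F differentiable (at \<xi>) \<and>
            norm (vector_derivative (fourier F) (at \<xi>)) \<le> c * \<bar>\<xi>\<bar> powr (\<alpha> - 1)))"

end

theory Submission
  imports Defs
begin

text \<open>Put \<open>g = \<phi> ^ n * (1 - \<phi>)\<close> with \<open>\<phi>\<close> the Fourier transform of \<open>F\<close>; this is the transform of
  the difference \<open>f\<close> of consecutive convolution powers. The hypotheses and aperiodicity give
  \<open>|\<phi> x| \<le> exp (- b |x| ^ \<alpha>)\<close>, so with \<open>N = n ^ (1 / \<alpha>)\<close> and a suitable \<open>K = O(1 / n)\<close>,
  \<open>|g x|\<close> is at most \<open>K\<close>, \<open>K / (N |x|)\<close> and \<open>K (N |x|) ^ \<beta>\<close>, and \<open>|g' x| \<le> K (N |x|) ^ \<beta> / |x|\<close>,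
  where \<open>\<beta> = \<alpha> / 2 < 1 / 2\<close>.

  The sum of \<open>|f k|\<close> over \<open>k \<le> N\<close> is \<open>O(K)\<close> by Cauchy--Schwarz and Bessel. Over a dyadic
  block \<open>k ~ 2 ^ j > N\<close> it is controlled by the mean square of \<open>g (x + h) - g x\<close> at \<open>h = 2 ^ - j\<close>;
  as \<open>g'\<close> need not be square integrable near \<open>0\<close>, the range \<open>|x| \<le> 2 h\<close> uses the bound
  on \<open>g\<close> instead. The blocks contribute \<open>O(K (N / 2 ^ j) ^ \<beta>)\<close>, a geometric series of size \<open>O(K)\<close>.

  For the perturbation statement, the transform of \<open>G - a F\<close> has a bounded derivative, and near \<open>0\<close> a
  Lipschitz error is negligible against \<open>|x| ^ \<alpha>\<close> since \<open>\<alpha> < 1\<close>.\<close>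

section \<open>Absolutely convergent trigonometric series\<close>

text \<open>Indexing by \<open>nat\<close> is enough because every distribution here lives on the
  nonnegative integers. Complex coefficients are allowed so that translation and differentiation in
  \<open>x\<close> lead to series of the same kind.\<close>

definition fser :: "(nat \<Rightarrow> complex) \<Rightarrow> real \<Rightarrow> complex" where
  "fser a x = (\<Sum>k. a k * cis (- (real k * x)))"

lemma fser_sums:
  assumes "summable (\<lambda>k. norm (a k))"
  shows "(\<lambda>k. a k * cis (- (real k * x))) sums fser a x"
  unfolding fser_def
  by (rule summable_sums, rule summable_norm_cancel) (use assms in \<open>simp add: norm_mult\<close>)

lemma fser_diff:
  assumes "summable (\<lambda>k. norm (a k))" "summable (\<lambda>k. norm (b k))"
  shows "fser (\<lambda>k. a k - b k) x = fser a x - fser b x"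
  using sums_diff[OF fser_sums[OF assms(1), of x] fser_sums[OF assms(2), of x]]
  by (simp add: fser_def sums_iff algebra_simps)

lemma fser_cmult:
  assumes "summable (\<lambda>k. norm (a k))"
  shows "fser (\<lambda>k. c * a k) x = c * fser a x"
  using sums_mult[OF fser_sums[OF assms, of x], of c] by (simp add: fser_def sums_iff mult.assoc)

lemma fser_shift: "fser a (x + h) = fser (\<lambda>k. a k * cis (- (real k * h))) x"
  unfolding fser_def by (intro suminf_cong) (simp add: algebra_simps cis_mult)

lemma fser_2pi: "fser a (x + 2 * pi) = fser a x"
proof -
  have "cis (- (real k * (x + 2 * pi))) = cis (- (real k * x))" for k
  proof -
    have "cis (- (real k * (x + 2 * pi))) = cis (- (real k * x)) * cis (2 * pi * (- real k))"
      by (simp add: cis_mult algebra_simps)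
    also have "cis (2 * pi * (- real k)) = 1"
      by (rule cis_multiple_2pi) auto
    finally show ?thesis by simp
  qed
  then show ?thesis by (simp add: fser_def)
qed

lemma fser_uniform_limit:
  assumes "summable (\<lambda>k. norm (a k))"
  shows "uniform_limit S (\<lambda>n x. \<Sum>k<n. a k * cis (- (real k * x))) (fser a) sequentially"
  unfolding fser_def by (rule Weierstrass_m_test[OF _ assms]) (simp add: norm_mult)

lemma continuous_on_fser:
  assumes "summable (\<lambda>k. norm (a k))"
  shows "continuous_on S (fser a)"
  by (rule uniform_limit_theorem[OF _ fser_uniform_limit[OF assms]])
     (auto intro!: always_eventually continuous_on_sum continuous_on_mult continuous_on_cis
        continuous_on_minus continuous_on_const continuous_on_id)

text \<open>The first moment dominates the differentiated series uniformly in \<open>x\<close>, so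
  termwise differentiation is legitimate. This serves for \<open>G - a F\<close>, not for
  \<open>F\<close> itself: the lower bound on \<open>1 - Re\<close> in \<open>hypI\<close> excludes
  a transform that is Lipschitz at 0.\<close>

lemma fser_has_vector_derivative:
  assumes sm: "summable (\<lambda>k. norm (a k))" and sm1: "summable (\<lambda>k. real k * norm (a k))"
  shows "(fser a has_vector_derivative fser (\<lambda>k. - \<i> * of_nat k * a k) x) (at x)"
    "norm (fser (\<lambda>k. - \<i> * of_nat k * a k) x) \<le> (\<Sum>k. real k * norm (a k))"
proof -
  define c where "c = (\<lambda>k. - \<i> * of_nat k * a k)"
  have nc: "norm (c k) = real k * norm (a k)" for k by (simp add: c_def norm_mult)
  have smc: "summable (\<lambda>k. norm (c k))" using sm1 by (simp add: nc)
  have "\<exists>g. \<forall>x\<in>UNIV. (\<lambda>k. a k * cis (- (real k * x))) sums g x \<and>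
      (g has_derivative (\<lambda>h. h *\<^sub>R fser c x)) (at x within UNIV)"
  proof (rule has_derivative_series[where x = 0 and l = "fser a 0" and f' = "\<lambda>k x h. h *\<^sub>R (c k * cis (- (real k * x)))"])
    show "((\<lambda>x. a k * cis (- (real k * x))) has_derivative (\<lambda>h. h *\<^sub>R (c k * cis (- (real k * x)))))
        (at x within UNIV)" for k x
      by (rule derivative_eq_intros | simp)+
         (auto simp: c_def fun_eq_iff scaleR_conv_of_real algebra_simps)
    show "\<forall>\<^sub>F n in sequentially. \<forall>x\<in>UNIV. \<forall>h.
        norm ((\<Sum>i<n. h *\<^sub>R (c i * cis (- (real i * x)))) - h *\<^sub>R fser c x) \<le> e * norm h"
      if "0 < e" for e
      using uniform_limitD[OF fser_uniform_limit[OF smc, of UNIV] that]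
    proof eventually_elim
      case (elim n)
      show ?case
      proof (intro ballI allI)
        fix x h :: real
        have "norm ((\<Sum>i<n. h *\<^sub>R (c i * cis (- (real i * x)))) - h *\<^sub>R fser c x)
            = \<bar>h\<bar> * norm ((\<Sum>i<n. c i * cis (- (real i * x))) - fser c x)"
          by (simp only: scaleR_sum_right[symmetric] scaleR_diff_right[symmetric] norm_scaleR)
        also have "\<dots> \<le> \<bar>h\<bar> * e"
          using elim by (intro mult_left_mono) (auto simp: dist_norm intro: less_imp_le)
        finally show "norm ((\<Sum>i<n. h *\<^sub>R (c i * cis (- (real i * x)))) - h *\<^sub>R fser c x) \<le> e * norm h"
          by (simp add: mult.commute)
      qed
    qed
  qed (use fser_sums[OF sm, of 0] in auto)
  then obtain g where g: "\<And>x. (\<lambda>k. a k * cis (- (real k * x))) sums g x"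
      "\<And>x. (g has_derivative (\<lambda>h. h *\<^sub>R fser c x)) (at x)"
    by auto
  have "g = fser a" using sums_unique2[OF g(1) fser_sums[OF sm]] by auto
  then show "(fser a has_vector_derivative fser (\<lambda>k. - \<i> * of_nat k * a k) x) (at x)"
    using g(2) by (simp add: has_vector_derivative_def c_def)
  have "norm (fser c x) \<le> (\<Sum>k. norm (c k))"
    by (rule norm_sums_le[OF fser_sums[OF smc] summable_sums[OF smc]]) (simp add: norm_mult)
  then show "norm (fser (\<lambda>k. - \<i> * of_nat k * a k) x) \<le> (\<Sum>k. real k * norm (a k))"
    by (simp only: nc) (simp add: c_def)
qed

section \<open>Orthogonality of the exponentials and Bessel's inequality\<close>

lemma integral_cis_int:
  fixes m :: int
  shows "((\<lambda>x. cis (of_int m * x)) has_integral (if m = 0 then of_real (2 * pi) else 0)) {-pi..pi}"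
proof (cases "m = 0")
  case True
  then show ?thesis
    using has_integral_const_real[of "1::complex" "-pi" pi]
    by (simp add: scaleR_conv_of_real)
next
  case False
  let ?f = "\<lambda>x. cis (of_int m * x) / (\<i> * of_int m)"
  have "((\<lambda>x. cis (of_int m * x)) has_integral (?f pi - ?f (-pi))) {-pi..pi}"
  proof (rule fundamental_theorem_of_calculus)
    fix x
    have "(?f has_vector_derivative ((of_int m *\<^sub>R (\<i> * cis (of_int m * x))) / (\<i> * of_int m)))
        (at x within {-pi..pi})"
      unfolding has_vector_derivative_def divide_inverse
      by (rule derivative_eq_intros | simp)+ (auto simp: fun_eq_iff scaleR_conv_of_real algebra_simps)
    then show "(?f has_vector_derivative cis (of_int m * x)) (at x within {-pi..pi})"
      using False by (simp add: scaleR_conv_of_real)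
  qed simp
  \<comment> \<open>For \<open>m \<noteq> 0\<close> the antiderivative has period
    \<open>2 * pi\<close>, so its values at the two ends agree.\<close>
  moreover have "?f pi - ?f (-pi) = 0"
  proof -
    have "cis (of_int m * pi) = cis (of_int m * (-pi)) * cis (2 * pi * of_int m)"
      by (simp add: cis_mult algebra_simps)
    also have "cis (2 * pi * of_int m) = 1" by (rule cis_multiple_2pi) auto
    finally show ?thesis by simp
  qed
  ultimately show ?thesis using False by simp
qed

text \<open>Expanding the squared modulus gives a double sum of exponentials, and only its diagonal
  survives integration.\<close>

lemma trig_poly_parseval:
  "((\<lambda>x. (norm (\<Sum>k<n. a k * cis (- (real k * x))))\<^sup>2) has_integral
      2 * pi * (\<Sum>k<n. (norm (a k))\<^sup>2)) {-pi..pi}"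
proof -
  let ?g = "\<lambda>x. \<Sum>k<n. \<Sum>l<n. a k * cnj (a l) * cis (of_int (int l - int k) * x)"
  let ?I = "\<Sum>k<n. \<Sum>l<n. a k * cnj (a l) * (if int l - int k = 0 then of_real (2 * pi) else 0)"
  have "(?g has_integral ?I) {-pi..pi}"
    by (intro has_integral_sum has_integral_mult_right integral_cis_int) auto
  then have *: "((Re \<circ> ?g) has_integral Re ?I) {-pi..pi}"
    by (rule has_integral_linear[OF _ bounded_linear_Re])
  have "?g x = of_real ((norm (\<Sum>k<n. a k * cis (- (real k * x))))\<^sup>2)" for x
  proof -
    have "of_real ((norm (\<Sum>k<n. a k * cis (- (real k * x))))\<^sup>2) =
       (\<Sum>k<n. a k * cis (- (real k * x))) * cnj (\<Sum>k<n. a k * cis (- (real k * x)))"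
      by (rule complex_norm_square)
    also have "\<dots> = ?g x"
      unfolding cnj_sum sum_product
    proof (intro sum.cong refl)
      fix k l
      have "cis (- (real k * x)) * cis (real l * x) = cis (of_int (int l - int k) * x)"
        by (simp add: cis_mult algebra_simps)
      then show "a k * cis (- (real k * x)) * cnj (a l * cis (- (real l * x))) =
         a k * cnj (a l) * cis (of_int (int l - int k) * x)"
        by (simp add: cis_cnj mult_ac) 
    qed
    finally show ?thesis by simp
  qed
  then have 1: "(Re \<circ> ?g) = (\<lambda>x. (norm (\<Sum>k<n. a k * cis (- (real k * x))))\<^sup>2)"
    by (simp only: o_def Re_complex_of_real)
  have "?I = (\<Sum>k<n. of_real (2 * pi * (norm (a k))\<^sup>2))"
  proof (intro sum.cong refl)
    fix k assume k: "k \<in> {..<n}"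
    have "(\<Sum>l<n. a k * cnj (a l) * (if int l - int k = 0 then of_real (2 * pi) else 0)) =
        (\<Sum>l<n. if k = l then a k * cnj (a l) * of_real (2 * pi) else 0)"
      by (intro sum.cong) auto
    also have "\<dots> = a k * cnj (a k) * of_real (2 * pi)"
      using k by simp
    also have "\<dots> = of_real (2 * pi * (norm (a k))\<^sup>2)"
      by (simp only: complex_norm_square[symmetric] of_real_mult mult_ac)
    finally show "(\<Sum>l<n. a k * cnj (a l) * (if int l - int k = 0 then of_real (2 * pi) else 0)) =
       complex_of_real (2 * pi * (norm (a k))\<^sup>2)" .
  qed
  then have 2: "Re ?I = 2 * pi * (\<Sum>k<n. (norm (a k))\<^sup>2)"
    by (simp add: sum_distrib_left)
  show ?thesis using * unfolding 1 2 .
qed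

text \<open>The partial sums are bounded by the total absolute sum, so the integrals in Parseval's
  identity converge by dominated convergence. Once the partial sums run past \<open>A\<close>, each
  of these integrals dominates the left-hand side.\<close>

lemma fser_bessel:
  assumes sm: "summable (\<lambda>k. norm (a k))" and "finite A"
  shows "2 * pi * (\<Sum>k\<in>A. (norm (a k))\<^sup>2) \<le> integral {-pi..pi} (\<lambda>x. (norm (fser a x))\<^sup>2)"
proof -
  let ?p = "\<lambda>n x. \<Sum>k<n. a k * cis (- (real k * x))"
  let ?M = "\<Sum>k. norm (a k)"
  have "norm (?p n x) \<le> ?M" for n x
  proof -
    have "norm (?p n x) \<le> (\<Sum>k<n. norm (a k))"
      by (rule sum_norm_le) (simp add: norm_mult)
    also have "\<dots> \<le> ?M" by (rule sum_le_suminf[OF sm]) auto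
    finally show ?thesis .
  qed
  then have bd: "norm ((norm (?p n x))\<^sup>2) \<le> ?M\<^sup>2" for n x
    using power_mono[of "norm (?p n x)" ?M 2] by simp
  have "(\<lambda>n. (norm (?p n x))\<^sup>2) \<longlonglongrightarrow> (norm (fser a x))\<^sup>2" for x
    by (intro tendsto_power tendsto_norm) (rule fser_sums[OF sm, unfolded sums_def])
  then have lim: "(\<lambda>n. integral {-pi..pi} (\<lambda>x. (norm (?p n x))\<^sup>2))
       \<longlonglongrightarrow> integral {-pi..pi} (\<lambda>x. (norm (fser a x))\<^sup>2)"
    by (rule dominated_convergence(2)[where h = "\<lambda>_. ?M\<^sup>2",
          OF has_integral_integrable[OF trig_poly_parseval] integrable_const_ivl bd])
  obtain N where N: "A \<subseteq> {..<N}" using \<open>finite A\<close> finite_nat_iff_bounded by blast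
  show ?thesis
  proof (rule tendsto_lowerbound[OF lim])
    show "\<forall>\<^sub>F n in sequentially. 2 * pi * (\<Sum>k\<in>A. (norm (a k))\<^sup>2)
        \<le> integral {-pi..pi} (\<lambda>x. (norm (?p n x))\<^sup>2)"
      using eventually_ge_at_top[of N]
    proof eventually_elim
      case (elim n)
      have "(\<Sum>k\<in>A. (norm (a k))\<^sup>2) \<le> (\<Sum>k<n. (norm (a k))\<^sup>2)"
        by (rule sum_mono2) (use N elim in auto)
      then show ?case
        unfolding integral_unique[OF trig_poly_parseval] by (intro mult_left_mono) auto
    qed
  qed simp
qed

text \<open>The majorant is \<open>K\<close> up to \<open>h\<close> and a power beyond, with
  integral at most 2Kh + 2Kh/(p - 1). It is used with p = 2 for a transform and with p = 2 -
  2\<beta> for its increments.\<close>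

lemma integral_le_power_tail:
  fixes u :: "real \<Rightarrow> real"
  assumes cont: "continuous_on {-pi..pi} u" and h: "0 < h" "h \<le> pi" and p: "1 < p" and "0 \<le> K"
    and near: "\<And>x. \<bar>x\<bar> \<le> h \<Longrightarrow> u x \<le> K"
    and far: "\<And>x. h \<le> \<bar>x\<bar> \<Longrightarrow> \<bar>x\<bar> \<le> pi \<Longrightarrow> u x \<le> K * (\<bar>x\<bar> / h) powr (- p)"
  shows "integral {-pi..pi} u \<le> 2 * K * h * (p / (p - 1))"
proof -
  let ?v = "\<lambda>x. K * (x / h) powr (- p)"
  let ?V = "\<lambda>x. K * h * (x / h) powr (1 - p) / (1 - p)"
  have int: "(?v has_integral (?V pi - ?V h)) {h..pi}"
  proof (rule fundamental_theorem_of_calculus[OF h(2)])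
    fix x assume "x \<in> {h..pi}"
    then have "x > 0" using h by auto
    then have "(?V has_real_derivative (K * h * ((1 - p) * (x / h) powr (1 - p - 1) * (1 / h)) / (1 - p))) (at x)"
      using h p by (auto intro!: derivative_eq_intros)
    also have "K * h * ((1 - p) * (x / h) powr (1 - p - 1) * (1 / h)) / (1 - p) = ?v x"
      using h p by simp
    finally have "(?V has_real_derivative ?v x) (at x)" .
    then show "(?V has_vector_derivative ?v x) (at x within {h..pi})"
      unfolding has_real_derivative_iff_has_vector_derivative by (rule has_vector_derivative_at_within)
  qed
  \<comment> \<open>As \<open>1 - p\<close> is negative, the contribution of the endpoint
    \<open>pi\<close> is nonpositive and may be dropped.\<close>
  have V: "?V pi - ?V h \<le> K * h / (p - 1)"
  proof -
    have "?V pi - ?V h = K * h / (p - 1) - K * h * (pi / h) powr (1 - p) / (p - 1)"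
    proof -
      have "y / (1 - p) = - (y / (p - 1))" for y
        using minus_divide_right[of y "p - 1"] by simp
      then show ?thesis using h by simp
    qed
    also have "\<dots> \<le> K * h / (p - 1)"
      using h p \<open>0 \<le> K\<close> by simp
    finally show ?thesis .
  qed
  have far_pos: "integral {h..pi} u \<le> K * h / (p - 1)"
  proof -
    have "integral {h..pi} u \<le> integral {h..pi} ?v"
    proof (rule integral_le)
      show "u integrable_on {h..pi}"
        by (intro integrable_continuous_real continuous_on_subset[OF cont]) (use h in auto)
      show "u x \<le> ?v x" if "x \<in> {h..pi}" for x using far[of x] that h by auto
    qed (use int in auto)
    then show ?thesis using V unfolding integral_unique[OF int] by (rule order_trans)
  qed
  have far_neg: "integral {-pi..-h} u \<le> K * h / (p - 1)"
  proof -
    have "integral {-pi..-h} u = integral {h..pi} (\<lambda>x. u (-x))"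
      using Henstock_Kurzweil_Integration.integral_reflect_real[where f = "\<lambda>x. u (-x)" and a = h and b = pi] by simp
    also have "\<dots> \<le> integral {h..pi} ?v"
    proof (rule integral_le)
      have "continuous_on {h..pi} (\<lambda>x. u (-x))"
        by (rule continuous_on_compose2[OF cont]) (use h in \<open>auto intro!: continuous_intros\<close>)
      then show "(\<lambda>x. u (-x)) integrable_on {h..pi}" by (rule integrable_continuous_real)
      show "u (-x) \<le> ?v x" if "x \<in> {h..pi}" for x using far[of "-x"] that h by auto
    qed (use int in auto)
    finally show ?thesis using V unfolding integral_unique[OF int] by (rule order_trans)
  qed
  have mid: "integral {-h..h} u \<le> 2 * K * h"
  proof -
    have "integral {-h..h} u \<le> integral {-h..h} (\<lambda>_. K)"
      by (rule integral_le)
         (use near h in \<open>auto intro!: integrable_continuous_real continuous_on_subset[OF cont]\<close>)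
    then show ?thesis using h by (simp add: algebra_simps)
  qed
  have I: "u integrable_on {-pi..pi}" by (rule integrable_continuous_real[OF cont])
  have "integral {-pi..pi} u = integral {-pi..-h} u + integral {-h..pi} u"
    by (rule Henstock_Kurzweil_Integration.integral_combine[symmetric]) (use h I in auto)
  also have "integral {-h..pi} u = integral {-h..h} u + integral {h..pi} u"
    by (rule Henstock_Kurzweil_Integration.integral_combine[symmetric])
       (use h in \<open>auto intro!: integrable_continuous_real continuous_on_subset[OF cont]\<close>)
  finally have "integral {-pi..pi} u \<le> 2 * K * h + 2 * (K * h / (p - 1))"
    using far_pos far_neg mid by simp
  also have "\<dots> = 2 * K * h * (p / (p - 1))"
    using p by (simp add: field_simps)
  finally show ?thesis .
qed

section \<open>Summability of coefficients from bounds on the series\<close>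

lemma vector_derivative_increment_bound:
  fixes f :: "real \<Rightarrow> 'a::real_normed_vector"
  assumes "0 \<le> h"
    and der: "\<And>y. x \<le> y \<Longrightarrow> y \<le> x + h \<Longrightarrow> f differentiable (at y) \<and> norm (vector_derivative f (at y)) \<le> B"
  shows "norm (f (x + h) - f x) \<le> B * h"
proof (cases "h = 0")
  case False
  then have "0 < h" using assms(1) by simp
  have "norm (f (x + h) - f x) \<le> B * (x + h) - B * x"
  proof (rule differentiable_bound_general)
    show "continuous_on {x..x+h} f"
      using der by (intro continuous_at_imp_continuous_on) (auto intro!: differentiable_imp_continuous_within)
    show "(f has_vector_derivative vector_derivative f (at y)) (at y)" if "x < y" "y < x + h" for y
      using der[of y] that vector_derivative_works by auto
    show "((\<lambda>y. B * y) has_vector_derivative B) (at y)" if "x < y" "y < x + h" for y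
      by (auto intro!: derivative_eq_intros simp: has_real_derivative_iff_has_vector_derivative[symmetric])
  qed (use \<open>0 < h\<close> der in \<open>auto intro!: continuous_intros\<close>)
  then show ?thesis by (simp add: algebra_simps)
qed simp

text \<open>The range is split at |x| = 2h. Inside, \<open>size\<close> is applied at both
  \<open>x\<close> and \<open>x + h\<close>; outside, the mean value inequality with
  \<open>der\<close> gives a square of order |x|^(2\<beta> - 2). The bounds are assumed up to
  \<open>pi + 1\<close> because \<open>x + h\<close> can leave the period interval by at most
  1.\<close>

lemma fser_increment_integral_le:
  assumes sm: "summable (\<lambda>k. norm (a k))" and \<beta>: "0 < \<beta>" "\<beta> < 1 / 2" and "0 \<le> A" and h: "0 < h" "h \<le> 1"
    and size: "\<And>x. \<bar>x\<bar> \<le> pi + 1 \<Longrightarrow> norm (fser a x) \<le> A * \<bar>x\<bar> powr \<beta>"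
    and der: "\<And>x. x \<noteq> 0 \<Longrightarrow> \<bar>x\<bar> \<le> pi + 1 \<Longrightarrow> fser a differentiable (at x) \<and>
        norm (vector_derivative (fser a) (at x)) \<le> A * \<bar>x\<bar> powr (\<beta> - 1)"
  shows "integral {-pi..pi} (\<lambda>x. (norm (fser a (x + h) - fser a x))\<^sup>2)
      \<le> 100 * ((2 - 2 * \<beta>) / (1 - 2 * \<beta>)) * A\<^sup>2 * h powr (1 + 2 * \<beta>)"
proof -
  have hh: "(h powr \<beta>)\<^sup>2 = h powr (2 * \<beta>)"
    by (simp add: power2_eq_square powr_add[symmetric])
  have cont: "continuous_on {-pi..pi} (\<lambda>x. (norm (fser a (x + h) - fser a x))\<^sup>2)"
    by (intro continuous_intros continuous_on_fser[OF sm]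
        continuous_on_compose2[OF continuous_on_fser[OF sm, of UNIV]]) auto
  have "integral {-pi..pi} (\<lambda>x. (norm (fser a (x + h) - fser a x))\<^sup>2)
      \<le> 2 * (25 * A\<^sup>2 * h powr (2 * \<beta>)) * (2 * h) * ((2 - 2 * \<beta>) / ((2 - 2 * \<beta>) - 1))"
  \<comment> \<open>The threshold is \<open>2 * h\<close>, and the exponent
    \<open>2 - 2 * \<beta>\<close> exceeds 1 because \<open>\<beta> < 1 / 2\<close>. The factor 25
    is the square of 3 + 2, from |x + h| \<le> 3h and |x| \<le> 2h in the inner range.\<close>
  proof (rule integral_le_power_tail[OF cont])
    show "0 < 2 * h" "2 * h \<le> pi" using h pi_gt3 by auto
    show "1 < 2 - 2 * \<beta>" using \<beta> by simp
    show "0 \<le> 25 * A\<^sup>2 * h powr (2 * \<beta>)" by simp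
  next
    fix x assume x: "\<bar>x\<bar> \<le> 2 * h"
    have powr_le: "\<bar>y\<bar> powr \<beta> \<le> c * h powr \<beta>" if "\<bar>y\<bar> \<le> c * h" "1 \<le> c" for y c
    proof -
      have "\<bar>y\<bar> powr \<beta> \<le> (c * h) powr \<beta>" using that \<beta> by (intro powr_mono2) auto
      also have "\<dots> = c powr \<beta> * h powr \<beta>" using that h by (simp add: powr_mult)
      also have "c powr \<beta> \<le> c powr 1" using that \<beta> by (intro powr_mono) auto
      finally show ?thesis using that by (simp add: mult_right_mono)
    qed
    have "norm (fser a (x + h) - fser a x) \<le> norm (fser a (x + h)) + norm (fser a x)"
      by (rule norm_triangle_ineq4)
    also have "\<dots> \<le> A * \<bar>x + h\<bar> powr \<beta> + A * \<bar>x\<bar> powr \<beta>"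
      using x h pi_gt3 by (intro add_mono size) auto
    also have "\<dots> \<le> A * (3 * h powr \<beta>) + A * (2 * h powr \<beta>)"
      using x h \<open>0 \<le> A\<close> by (intro add_mono mult_left_mono powr_le) auto
    finally have "norm (fser a (x + h) - fser a x) \<le> 5 * A * h powr \<beta>" by simp
    then have "(norm (fser a (x + h) - fser a x))\<^sup>2 \<le> (5 * A * h powr \<beta>)\<^sup>2"
      by (intro power_mono) auto
    then show "(norm (fser a (x + h) - fser a x))\<^sup>2 \<le> 25 * A\<^sup>2 * h powr (2 * \<beta>)"
      by (simp add: power_mult_distrib hh)
  next
    fix x assume x: "2 * h \<le> \<bar>x\<bar>" "\<bar>x\<bar> \<le> pi"
    have "norm (fser a (x + h) - fser a x) \<le> (A * (\<bar>x\<bar> / 2) powr (\<beta> - 1)) * h"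
    proof (rule vector_derivative_increment_bound)
      fix y assume y: "x \<le> y" "y \<le> x + h"
      \<comment> \<open>Since h \<le> |x| / 2, the segment from \<open>x\<close> to
        \<open>x + h\<close> stays at distance at least |x| / 2 from the singularity at 0.\<close>
      have y1: "\<bar>x\<bar> / 2 \<le> \<bar>y\<bar>" "\<bar>y\<bar> \<le> pi + 1" using x y h by linarith+
      have "\<bar>y\<bar> powr (\<beta> - 1) \<le> (\<bar>x\<bar> / 2) powr (\<beta> - 1)"
        using y1 x h \<beta> by (intro powr_mono2') auto
      then have "A * \<bar>y\<bar> powr (\<beta> - 1) \<le> A * (\<bar>x\<bar> / 2) powr (\<beta> - 1)"
        using \<open>0 \<le> A\<close> by (rule mult_left_mono)
      moreover have "y \<noteq> 0" using y1 x h by auto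
      ultimately show "fser a differentiable (at y) \<and>
          norm (vector_derivative (fser a) (at y)) \<le> A * (\<bar>x\<bar> / 2) powr (\<beta> - 1)"
        using der[of y] y1 by auto
    qed (use h in auto)
    also have "(\<bar>x\<bar> / 2) powr (\<beta> - 1) = h powr (\<beta> - 1) * (\<bar>x\<bar> / (2 * h)) powr (\<beta> - 1)"
      using h x by (subst powr_mult[symmetric]) (auto simp: field_simps)
    also have "(A * (h powr (\<beta> - 1) * (\<bar>x\<bar> / (2 * h)) powr (\<beta> - 1))) * h
        = A * h powr \<beta> * (\<bar>x\<bar> / (2 * h)) powr (\<beta> - 1)"
      using h by (simp add: powr_diff)
    finally have "(norm (fser a (x + h) - fser a x))\<^sup>2 \<le> (A * h powr \<beta> * (\<bar>x\<bar> / (2 * h)) powr (\<beta> - 1))\<^sup>2"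
      by (intro power_mono) auto
    also have "\<dots> = A\<^sup>2 * h powr (2 * \<beta>) * (\<bar>x\<bar> / (2 * h)) powr (- (2 - 2 * \<beta>))"
    proof -
      have "((\<bar>x\<bar> / (2 * h)) powr (\<beta> - 1))\<^sup>2 = (\<bar>x\<bar> / (2 * h)) powr (- (2 - 2 * \<beta>))"
        by (simp add: power2_eq_square powr_add[symmetric])
      then show ?thesis by (simp only: power_mult_distrib hh)
    qed
    \<comment> \<open>The factor 25 is inserted only so that both ranges share one constant.\<close>
    also have "\<dots> \<le> 25 * A\<^sup>2 * h powr (2 * \<beta>) * (\<bar>x\<bar> / (2 * h)) powr (- (2 - 2 * \<beta>))"
      by (intro mult_right_mono) auto
    finally show "(norm (fser a (x + h) - fser a x))\<^sup>2
        \<le> 25 * A\<^sup>2 * h powr (2 * \<beta>) * (\<bar>x\<bar> / (2 * h)) powr (- (2 - 2 * \<beta>))" .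
  qed
  also have "\<dots> = 100 * ((2 - 2 * \<beta>) / (1 - 2 * \<beta>)) * A\<^sup>2 * h powr (1 + 2 * \<beta>)"
    using h by (simp add: powr_add)
  finally show ?thesis .
qed

section \<open>From mean squares to absolute sums of coefficients\<close>

lemma sum_le_sqrt_card:
  fixes f :: "'a \<Rightarrow> real"
  shows "(\<Sum>k\<in>A. f k) \<le> sqrt (real (card A) * (\<Sum>k\<in>A. (f k)\<^sup>2))"
  using Cauchy_Schwarz_ineq_sum[of f "\<lambda>_. 1" A] by (intro real_le_rsqrt) (simp add: mult.commute)

text \<open>The increment \<^term>\<open>\<lambda>x. fser a (x + h) - fser a x\<close> has coefficients
  \<^term>\<open>\<lambda>k. a k * (cis (- (real k * h)) - 1)\<close>, and for \<^term>\<open>h = 1 / 2 ^ j\<close> the factor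
  is bounded away from \<^term>\<open>0::real\<close> on the block.\<close>

lemma fser_dyadic_block_le:
  assumes sm: "summable (\<lambda>k. norm (a k))" and \<beta>: "0 < \<beta>" "\<beta> < 1 / 2" and "0 \<le> A"
    and size: "\<And>x. \<bar>x\<bar> \<le> pi + 1 \<Longrightarrow> norm (fser a x) \<le> A * \<bar>x\<bar> powr \<beta>"
    and der: "\<And>x. x \<noteq> 0 \<Longrightarrow> \<bar>x\<bar> \<le> pi + 1 \<Longrightarrow> fser a differentiable (at x) \<and>
        norm (vector_derivative (fser a) (at x)) \<le> A * \<bar>x\<bar> powr (\<beta> - 1)"
  shows "(\<Sum>k\<in>{2^j..<2^(j+1)}. norm (a k))
      \<le> sqrt (100 * ((2 - 2 * \<beta>) / (1 - 2 * \<beta>)) / (2 - 2 * cos 1)) * A * (1 / 2 ^ j) powr \<beta>"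
proof -
  define h :: real where "h = 1 / 2 ^ j"
  have h: "0 < h" "h \<le> 1" by (auto simp: h_def)
  let ?B = "{2^j..<2^(j+1)} :: nat set"
  let ?D = "100 * ((2 - 2 * \<beta>) / (1 - 2 * \<beta>))"
  let ?b = "\<lambda>k. a k * cis (- (real k * h)) - a k"
  have cos1: "cos 1 < (1::real)" using cos_monotone_0_pi[of 0 1] pi_gt3 by auto
  have smh: "summable (\<lambda>k. norm (a k * cis (- (real k * h))))" using sm by (simp add: norm_mult)
  have smb: "summable (\<lambda>k. norm (?b k))"
    by (rule summable_comparison_test'[OF summable_add[OF smh sm]]) (simp add: norm_triangle_ineq4)
  have inc: "fser ?b x = fser a (x + h) - fser a x" for x
    unfolding fser_shift by (rule fser_diff[OF smh sm])
  have "(2 - 2 * cos 1) * (norm (a k))\<^sup>2 \<le> (norm (?b k))\<^sup>2" if "k \<in> ?B" for k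
  proof -
    have "real (2 ^ j) \<le> real k" "real k \<le> real (2 * 2 ^ j)"
      using that by (simp_all only: of_nat_le_iff) auto
    then have "2 ^ j \<le> real k" "real k \<le> 2 * 2 ^ j" by simp_all
    \<comment> \<open>On the block, kh lies in [1, 2], where the cosine decreases. Hence the squared
      modulus 2 - 2 cos (kh) of the factor is at least \<open>2 - 2 * cos 1\<close>.\<close>
    then have kh: "1 \<le> real k * h" "real k * h \<le> 2" by (auto simp: h_def field_simps)
    then have c: "cos (real k * h) \<le> cos 1" using pi_gt3 by (intro cos_monotone_0_pi_le) auto
    have "?b k = a k * (cis (- (real k * h)) - 1)" by (simp add: algebra_simps)
    then have "(norm (?b k))\<^sup>2 = (norm (a k))\<^sup>2 * (norm (cis (- (real k * h)) - 1))\<^sup>2"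
      by (simp add: norm_mult power_mult_distrib)
    also have "(norm (cis (- (real k * h)) - 1))\<^sup>2 = 2 - 2 * cos (real k * h)"
      using sin_cos_squared_add[of "real k * h"] by (simp add: cmod_power2 power2_diff)
    finally show ?thesis using c by (simp add: mult.commute mult_left_mono)
  qed
  then have "(2 - 2 * cos 1) * (\<Sum>k\<in>?B. (norm (a k))\<^sup>2) \<le> (\<Sum>k\<in>?B. (norm (?b k))\<^sup>2)"
    unfolding sum_distrib_left by (rule sum_mono)
  also have "\<dots> \<le> 2 * pi * (\<Sum>k\<in>?B. (norm (?b k))\<^sup>2)"
    using pi_gt3 sum_nonneg[of ?B "\<lambda>k. (norm (?b k))\<^sup>2"]
    by (intro mult_right_mono[of 1 "2 * pi", simplified]) auto
  also have "\<dots> \<le> integral {-pi..pi} (\<lambda>x. (norm (fser a (x + h) - fser a x))\<^sup>2)"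
    using fser_bessel[OF smb, of ?B] by (simp add: inc)
  also have "\<dots> \<le> ?D * A\<^sup>2 * h powr (1 + 2 * \<beta>)"
    by (rule fser_increment_integral_le[OF sm \<beta> \<open>0 \<le> A\<close> h size der])
  finally have sq: "(\<Sum>k\<in>?B. (norm (a k))\<^sup>2) \<le> ?D / (2 - 2 * cos 1) * A\<^sup>2 * h powr (1 + 2 * \<beta>)"
    using cos1 divide_right_mono[of "(2 - 2 * cos 1) * (\<Sum>k\<in>?B. (norm (a k))\<^sup>2)"
        "?D * A\<^sup>2 * h powr (1 + 2 * \<beta>)" "2 - 2 * cos 1"] by simp
  have "(\<Sum>k\<in>?B. norm (a k)) \<le> sqrt (real (card ?B) * (\<Sum>k\<in>?B. (norm (a k))\<^sup>2))"
    by (rule sum_le_sqrt_card)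
  \<comment> \<open>The block has 2^j = 1/h indices; this loss in Cauchy--Schwarz is compensated by
    one power of \<open>h\<close> in \<open>h powr (1 + 2 * \<beta>)\<close>.\<close>
  also have "\<dots> \<le> sqrt ((1 / h) * (?D / (2 - 2 * cos 1) * A\<^sup>2 * h powr (1 + 2 * \<beta>)))"
    using sq h by (intro real_sqrt_le_mono mult_mono sum_nonneg) (auto simp: h_def)
  also have "(1 / h) * (?D / (2 - 2 * cos 1) * A\<^sup>2 * h powr (1 + 2 * \<beta>))
      = ?D / (2 - 2 * cos 1) * (A * h powr \<beta>)\<^sup>2"
  proof -
    have "h powr (1 + 2 * \<beta>) = h * (h powr \<beta>)\<^sup>2"
      using h powr_add[of h 1 "2 * \<beta>"] powr_add[of h \<beta> \<beta>] by (simp add: power2_eq_square)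
    then show ?thesis using h by (simp add: power_mult_distrib)
  qed
  also have "sqrt \<dots> = sqrt (?D / (2 - 2 * cos 1)) * A * h powr \<beta>"
    using \<open>0 \<le> A\<close> by (simp only: real_sqrt_mult real_sqrt_abs) simp
  finally show ?thesis by (simp add: h_def)
qed

text \<open>The constant does not depend on the scale \<open>N\<close>, which separates the coefficients treated by
  a single Cauchy--Schwarz estimate from those treated block by block.\<close>

lemma fser_l1_bound:
  assumes \<beta>: "0 < \<beta>" "\<beta> < 1 / 2"
  obtains C :: real where "0 < C"
    "\<And>a N K. \<lbrakk>summable (\<lambda>k. norm (a k)); 1 \<le> N; 0 \<le> K;
        \<And>x. \<bar>x\<bar> \<le> pi + 1 \<Longrightarrow> norm (fser a x) \<le> K;
        \<And>x. x \<noteq> 0 \<Longrightarrow> \<bar>x\<bar> \<le> pi + 1 \<Longrightarrow> norm (fser a x) \<le> K / (N * \<bar>x\<bar>);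
        \<And>x. \<bar>x\<bar> \<le> pi + 1 \<Longrightarrow> norm (fser a x) \<le> K * (N * \<bar>x\<bar>) powr \<beta>;
        \<And>x. x \<noteq> 0 \<Longrightarrow> \<bar>x\<bar> \<le> pi + 1 \<Longrightarrow> fser a differentiable (at x) \<and>
          norm (vector_derivative (fser a) (at x)) \<le> K * (N * \<bar>x\<bar>) powr \<beta> / \<bar>x\<bar>\<rbrakk>
      \<Longrightarrow> (\<Sum>k. norm (a k)) \<le> C * K"
proof -
  \<comment> \<open>\<open>D\<close> is the constant for one block and \<open>q\<close> the ratio
    between the bounds for successive blocks. In \<open>C\<close>, the 2 pays for the indices below
    the scale \<open>N\<close>, and \<open>2 powr \<beta>\<close> for rounding \<open>N\<close> down
    to a power of 2.\<close>
  define D where "D = sqrt (100 * ((2 - 2 * \<beta>) / (1 - 2 * \<beta>)) / (2 - 2 * cos 1))"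
  define q :: real where "q = 2 powr (- \<beta>)"
  define C where "C = 2 + D * 2 powr \<beta> / (1 - q)"
  have cos1: "cos 1 < (1::real)" using cos_monotone_0_pi[of 0 1] pi_gt3 by auto
  have D: "0 \<le> D" using \<beta> cos1 by (simp add: D_def)
  have q: "0 < q" "q < 1" using \<beta> powr_less_mono[of "-\<beta>" 0 2] by (auto simp: q_def)
  have "0 < C" using D q by (auto simp: C_def intro!: add_pos_nonneg)
  moreover have "(\<Sum>k. norm (a k)) \<le> C * K"
    if sm: "summable (\<lambda>k. norm (a k))" and N: "1 \<le> N" and K: "0 \<le> K"
      and bd: "\<And>x. \<bar>x\<bar> \<le> pi + 1 \<Longrightarrow> norm (fser a x) \<le> K"
      and dec: "\<And>x. x \<noteq> 0 \<Longrightarrow> \<bar>x\<bar> \<le> pi + 1 \<Longrightarrow> norm (fser a x) \<le> K / (N * \<bar>x\<bar>)"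
      and size: "\<And>x. \<bar>x\<bar> \<le> pi + 1 \<Longrightarrow> norm (fser a x) \<le> K * (N * \<bar>x\<bar>) powr \<beta>"
      and der: "\<And>x. x \<noteq> 0 \<Longrightarrow> \<bar>x\<bar> \<le> pi + 1 \<Longrightarrow> fser a differentiable (at x) \<and>
          norm (vector_derivative (fser a) (at x)) \<le> K * (N * \<bar>x\<bar>) powr \<beta> / \<bar>x\<bar>"
    for a N K
  proof -
    obtain J where J: "2 ^ J \<le> N" "N < 2 ^ (J + 1)"
    proof -
      define J where "J = nat \<lfloor>log 2 N\<rfloor>"
      have "0 \<le> log 2 N" using N by simp
      then have "real J \<le> log 2 N" "log 2 N < real (J + 1)" unfolding J_def by linarith+
      then have "2 powr (real J) \<le> N" "N < 2 powr (real (J + 1))"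
        using N by (simp_all only: powr_le_iff less_powr_iff)
      then show ?thesis using that[of J] by (simp add: powr_realpow del: of_nat_add of_nat_Suc)
    qed
    have low: "(\<Sum>k<2^J. norm (a k)) \<le> 2 * K"
    proof -
      have "2 * pi * (\<Sum>k<2^J. (norm (a k))\<^sup>2) \<le> integral {-pi..pi} (\<lambda>x. (norm (fser a x))\<^sup>2)"
        by (rule fser_bessel[OF sm]) simp
      also have "\<dots> \<le> 2 * K\<^sup>2 * (1 / N) * (2 / (2 - 1))"
      \<comment> \<open>The threshold is \<open>1 / N\<close> and the exponent 2: \<open>bd\<close>
        is used below it and \<open>dec\<close> above it. The resulting order K^2 / N balances the
        at most \<open>N\<close> indices in Cauchy--Schwarz, so that the scale drops out.\<close>
      proof (rule integral_le_power_tail)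
        show "continuous_on {-pi..pi} (\<lambda>x. (norm (fser a x))\<^sup>2)"
          by (intro continuous_intros continuous_on_fser[OF sm])
        have "1 / N \<le> 1" using N by simp
        then show N1: "1 / N \<le> pi" using pi_gt3 by linarith
        show "(norm (fser a x))\<^sup>2 \<le> K\<^sup>2" if "\<bar>x\<bar> \<le> 1 / N" for x
          using bd[of x] that N1 by (intro power_mono) auto
        show "(norm (fser a x))\<^sup>2 \<le> K\<^sup>2 * (\<bar>x\<bar> / (1 / N)) powr (- 2)"
          if "1 / N \<le> \<bar>x\<bar>" "\<bar>x\<bar> \<le> pi" for x
        proof -
          have "0 < 1 / N" using N by simp
          then have x0: "x \<noteq> 0" using that by linarith
          have "(norm (fser a x))\<^sup>2 \<le> (K / (N * \<bar>x\<bar>))\<^sup>2"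
            using dec[OF x0] that by (intro power_mono) auto
          also have "\<dots> = K\<^sup>2 * (\<bar>x\<bar> / (1 / N)) powr (- 2)"
            using N x0 by (simp add: powr_minus power_divide divide_inverse power_mult_distrib power_inverse mult_ac)
          finally show ?thesis .
        qed
      qed (use N in auto)
      finally have "(\<Sum>k<2^J. (norm (a k))\<^sup>2) \<le> (4 * K\<^sup>2 / N) / (2 * pi)"
        by (subst pos_le_divide_eq) (simp_all add: mult.commute)
      also have "\<dots> \<le> (4 * K\<^sup>2 / N) / 1"
        using pi_gt3 N by (intro divide_left_mono) auto
      finally have sq: "(\<Sum>k<2^J. (norm (a k))\<^sup>2) \<le> 4 * K\<^sup>2 / N" by simp
      have "(\<Sum>k<2^J. norm (a k)) \<le> sqrt (real (card {..<2^J::nat}) * (\<Sum>k<2^J. (norm (a k))\<^sup>2))"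
        by (rule sum_le_sqrt_card)
      also have "\<dots> \<le> sqrt (N * (4 * K\<^sup>2 / N))"
        using sq J N by (intro real_sqrt_le_mono mult_mono sum_nonneg) auto
      also have "\<dots> = 2 * K" using N K by (simp add: real_sqrt_mult)
      finally show ?thesis .
    qed
    have high: "(\<Sum>k\<in>{2^j..<2^(j+1)}. norm (a k)) \<le> D * (K * N powr \<beta>) * (1 / 2 ^ j) powr \<beta>" for j
      unfolding D_def
    proof (rule fser_dyadic_block_le[OF sm \<beta>])
      show "0 \<le> K * N powr \<beta>" using K by simp
      show "norm (fser a x) \<le> K * N powr \<beta> * \<bar>x\<bar> powr \<beta>" if "\<bar>x\<bar> \<le> pi + 1" for x
        using size[OF that] N by (simp add: powr_mult)
      show "fser a differentiable (at x) \<and>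
          norm (vector_derivative (fser a) (at x)) \<le> K * N powr \<beta> * \<bar>x\<bar> powr (\<beta> - 1)"
        if "x \<noteq> 0" "\<bar>x\<bar> \<le> pi + 1" for x
        using der[OF that] N that(1) by (simp add: powr_mult powr_diff)
    qed
    \<comment> \<open>The first block starts at \<open>2 ^ J\<close>, which is within a factor 2 of
      \<open>N\<close>, so from there on the block bounds form a geometric sequence whose first term
      no longer depends on \<open>N\<close>.\<close>
    have block: "(\<Sum>k\<in>{2^(J+i)..<2^(J+i+1)}. norm (a k)) \<le> D * K * 2 powr \<beta> * q ^ i" for i
    proof -
      have "N powr \<beta> * (1 / 2 ^ (J + i)) powr \<beta> = (N / 2 ^ J) powr \<beta> * (1 / 2 ^ i) powr \<beta>"
        using N by (subst (1 2) powr_mult[symmetric]) (auto simp: power_add)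
      also have "(1 / 2 ^ i) powr \<beta> = q ^ i"
        by (simp add: q_def powr_minus powr_divide powr_powr power_one_over inverse_eq_divide
            flip: powr_realpow) (simp add: mult.commute)
      also have "(N / 2 ^ J) powr \<beta> \<le> 2 powr \<beta>"
        using J N \<beta> by (intro powr_mono2) (auto simp: field_simps)
      finally have "N powr \<beta> * (1 / 2 ^ (J + i)) powr \<beta> \<le> 2 powr \<beta> * q ^ i"
        using q by simp
      then have "(D * K) * (N powr \<beta> * (1 / 2 ^ (J + i)) powr \<beta>) \<le> (D * K) * (2 powr \<beta> * q ^ i)"
        using D K by (intro mult_left_mono) auto
      then show ?thesis using high[of "J + i"] by (simp add: mult_ac)
    qed
    have part: "(\<Sum>k<2^(J+m). norm (a k)) \<le> 2 * K + D * K * 2 powr \<beta> * (\<Sum>i<m. q ^ i)" for m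
    proof (induction m)
      case 0
      then show ?case using low by simp
    next
      case (Suc m)
      have "(\<Sum>k<2^(J+Suc m). norm (a k)) =
         (\<Sum>k<2^(J+m). norm (a k)) + (\<Sum>k\<in>{2^(J+m)..<2^(J+m+1)}. norm (a k))"
        using sum.atLeastLessThan_concat[of 0 "2^(J+m)" "2^(J+m+1)" "\<lambda>k. norm (a k)"]
        by (simp add: lessThan_atLeast0)
      then show ?case using Suc.IH block[of m] by (simp add: algebra_simps)
    qed
    have geo: "(\<Sum>i<m. q ^ i) \<le> 1 / (1 - q)" for m
      using q by (simp add: sum_gp_strict divide_right_mono)
    show ?thesis
    proof (rule suminf_le_const[OF sm])
      fix n
      have "n < 2 ^ n" by (rule less_exp)
      also have "(2::nat) ^ n \<le> 2 ^ (J + n)" by (intro power_increasing) auto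
      finally have "(\<Sum>k<n. norm (a k)) \<le> (\<Sum>k<2^(J+n). norm (a k))"
        by (intro sum_mono2) auto
      also have "\<dots> \<le> 2 * K + D * K * 2 powr \<beta> * (1 / (1 - q))"
        by (rule order_trans[OF part]) (intro add_left_mono mult_left_mono geo, use D K in simp)
      also have "\<dots> = C * K" by (simp add: C_def field_simps)
      finally show "(\<Sum>k<n. norm (a k)) \<le> C * K" .
    qed
  qed
  ultimately show ?thesis using that by blast
qed

section \<open>Transforms of convolution powers\<close>

abbreviation coeff_seq :: "(int \<Rightarrow> real) \<Rightarrow> nat \<Rightarrow> complex" where
  "coeff_seq F k \<equiv> of_real (F (int k))"

text \<open>Carries the unordered sums over \<open>int\<close> in the definitions to sums over
  \<open>nat\<close>, where the theory of series applies.\<close>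

lemma has_sum_int_nat:
  assumes "\<forall>k<0. f k = 0"
  shows "(f has_sum s) UNIV \<longleftrightarrow> ((\<lambda>n. f (int n)) has_sum s) UNIV"
proof -
  have "k \<in> range int" if "f k \<noteq> 0" for k
    using that assms by (metis not_less nonneg_int_cases rangeI)
  then have "(f has_sum s) UNIV \<longleftrightarrow> (f has_sum s) (range int)"
    by (intro has_sum_cong_neutral) auto
  also have "\<dots> \<longleftrightarrow> ((f \<circ> int) has_sum s) UNIV"
    by (rule has_sum_reindex) simp
  finally show ?thesis by (simp add: o_def)
qed

lemma fourier_eq_fser:
  assumes "\<forall>k<0. F k = 0" "summable (\<lambda>k. norm (coeff_seq F k))"
  shows "fourier F x = fser (coeff_seq F) x"
proof -
  have "((\<lambda>k. coeff_seq F k * cis (- (real k * x))) has_sum fser (coeff_seq F) x) UNIV"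
    by (rule norm_summable_imp_has_sum[OF _ fser_sums[OF assms(2)]])
       (use assms(2) in \<open>simp add: norm_mult\<close>)
  moreover have "complex_of_real (F (int k)) * exp (- \<i> * of_int (int k) * of_real x)
      = coeff_seq F k * cis (- (real k * x))" for k
    by (simp add: cis_conv_exp mult_ac)
  ultimately have "((\<lambda>k. complex_of_real (F k) * exp (- \<i> * of_int k * of_real x))
      has_sum fser (coeff_seq F) x) UNIV"
    using assms(1) by (subst has_sum_int_nat) (simp_all only:, simp)
  then show ?thesis unfolding fourier_def by (rule infsumI)
qed

lemma prob_Zplus_sums:
  assumes "prob_Zplus F"
  shows "(\<lambda>k. F (int k)) sums 1" "\<And>k. 0 \<le> F k" "\<forall>k<0. F k = 0" "summable (\<lambda>k. norm (coeff_seq F k))"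
proof -
  show nn: "\<And>k. 0 \<le> F k" and z: "\<forall>k<0. F k = 0" using assms by (auto simp: prob_Zplus_def)
  show s: "(\<lambda>k. F (int k)) sums 1"
    using assms z has_sum_int_nat[of F 1] by (intro has_sum_imp_sums) (simp add: prob_Zplus_def)
  show "summable (\<lambda>k. norm (coeff_seq F k))" using sums_summable[OF s] nn by simp
qed

lemma fourier_prob: "prob_Zplus F \<Longrightarrow> fourier F = fser (coeff_seq F)"
  using fourier_eq_fser[of F] prob_Zplus_sums[of F] by auto

lemma fser_prob_0: "prob_Zplus F \<Longrightarrow> fser (coeff_seq F) 0 = 1"
  using prob_Zplus_sums(1)[THEN sums_of_real[where 'a = complex]] by (simp add: fser_def sums_iff)

lemma fser_of_real_uminus:
  assumes "summable (\<lambda>k. norm (complex_of_real (u k)))"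
  shows "fser (\<lambda>k. of_real (u k)) (- x) = cnj (fser (\<lambda>k. of_real (u k)) x)"
proof -
  have "(\<lambda>k. cnj (of_real (u k) * cis (- (real k * x)))) sums cnj (fser (\<lambda>k. of_real (u k)) x)"
    using fser_sums[OF assms, of x] by (simp only: sums_cnj)
  then show ?thesis by (simp add: fser_def cis_cnj sums_iff)
qed

section \<open>Convolution as multiplication of transforms\<close>

lemma conv_negative:
  assumes "\<forall>k<0. F k = 0" "\<forall>k<0. G k = 0" "k < 0"
  shows "conv F G k = 0"
proof -
  have "F j * G (k - j) = 0" for j using assms by (cases "j < 0") auto
  then show ?thesis unfolding conv_def by (simp only: infsum_0)
qed

text \<open>The summand vanishes unless both arguments are nonnegative, which leaves exactly the
  finite sum of a Cauchy product.\<close>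

lemma conv_int:
  assumes "\<forall>k<0. F k = 0" "\<forall>k<0. G k = 0"
  shows "conv F G (int n) = (\<Sum>i\<le>n. F (int i) * G (int (n - i)))"
proof -
  have "F j * G (int n - j) = 0" if "j \<notin> int ` {..n}" for j
  proof (cases "j < 0 \<or> int n - j < 0")
    case False
    then have "j = int (nat j)" "nat j \<le> n" by auto
    then have "j \<in> int ` {..n}" by blast
    then show ?thesis using that by blast
  qed (use assms in auto)
  then have "conv F G (int n) = infsum (\<lambda>j. F j * G (int n - j)) (int ` {..n})"
    unfolding conv_def by (intro infsum_cong_neutral) auto
  also have "\<dots> = (\<Sum>i\<le>n. F (int i) * G (int n - int i))"
    by (simp add: sum.reindex)
  also have "\<dots> = (\<Sum>i\<le>n. F (int i) * G (int (n - i)))"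
    by (intro sum.cong) (auto simp: of_nat_diff)
  finally show ?thesis .
qed

lemma conv_fser:
  assumes F: "\<forall>k<0. F k = 0" "\<And>k. 0 \<le> F k" "summable (\<lambda>k. norm (coeff_seq F k))"
    and G: "\<forall>k<0. G k = 0" "\<And>k. 0 \<le> G k" "summable (\<lambda>k. norm (coeff_seq G k))"
  shows "\<And>k. 0 \<le> conv F G k" "summable (\<lambda>k. norm (coeff_seq (conv F G) k))"
    "fser (coeff_seq (conv F G)) x = fser (coeff_seq F) x * fser (coeff_seq G) x"
proof -
  show nn: "0 \<le> conv F G k" for k
    unfolding conv_def using F(2) G(2) by (intro infsum_nonneg) auto
  have "summable (\<lambda>k. \<Sum>i\<le>k. F (int i) * G (int (k - i)))"
    by (rule summable_Cauchy_product) (use F G in auto)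
  \<comment> \<open>Nonnegativity turns plain summability of the Cauchy product into absolute
    summability.\<close>
  then show "summable (\<lambda>k. norm (coeff_seq (conv F G) k))"
    using nn by (simp only: conv_int[OF F(1) G(1), symmetric]) simp
  have "fser (coeff_seq F) x * fser (coeff_seq G) x =
     (\<Sum>k. \<Sum>i\<le>k. (coeff_seq F i * cis (- (real i * x))) * (coeff_seq G (k - i) * cis (- (real (k - i) * x))))"
    unfolding fser_def
    by (rule Cauchy_product) (use F(3) G(3) in \<open>simp_all add: norm_mult\<close>)
  also have "\<dots> = fser (coeff_seq (conv F G)) x"
    unfolding fser_def
  proof (rule suminf_cong)
    fix k
    have "(coeff_seq F i * cis (- (real i * x))) * (coeff_seq G (k - i) * cis (- (real (k - i) * x)))
        = coeff_seq F i * coeff_seq G (k - i) * cis (- (real k * x))" if "i \<le> k" for i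
    proof -
      have "cis (- (real i * x)) * cis (- (real (k - i) * x)) = cis (- (real k * x))"
        using that by (simp add: cis_mult of_nat_diff algebra_simps)
      then show ?thesis by (metis mult.assoc mult.left_commute)
    qed
    then show "(\<Sum>i\<le>k. (coeff_seq F i * cis (- (real i * x))) * (coeff_seq G (k - i) * cis (- (real (k - i) * x))))
       = coeff_seq (conv F G) k * cis (- (real k * x))"
      unfolding conv_int[OF F(1) G(1)] of_real_sum of_real_mult sum_distrib_right
      by (intro sum.cong refl) (simp only: atMost_iff)
  qed
  finally show "fser (coeff_seq (conv F G)) x = fser (coeff_seq F) x * fser (coeff_seq G) x" by simp
qed

text \<open>The four facts form one induction statement because each convolution step needs the
  support, sign and summability of the previous power.\<close>

lemma convpow_fser:
  assumes F: "prob_Zplus F"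
  shows "(\<forall>k<0. convpow F n k = 0) \<and> (\<forall>k. 0 \<le> convpow F n k) \<and>
     summable (\<lambda>k. norm (coeff_seq (convpow F n) k)) \<and>
     (\<forall>x. fser (coeff_seq (convpow F n)) x = fser (coeff_seq F) x ^ n)"
proof (induction n)
  case 0
  have "(\<lambda>k. coeff_seq (delta 0) k * cis (- (real k * x))) sums 1" for x
    using sums_single[of 0 "\<lambda>k. 1::complex"]
    by (rule back_subst[of "\<lambda>f. f sums 1"]) (auto simp: delta_def)
  moreover have "summable (\<lambda>k. norm (coeff_seq (delta 0) k))"
    by (rule summable_finite[of "{0}"]) (auto simp: delta_def)
  ultimately show ?case by (auto simp: delta_def fser_def sums_iff)
next
  case (Suc n)
  note F' = prob_Zplus_sums[OF F]
  from Suc have G: "\<forall>k<0. convpow F n k = 0" "\<And>k. 0 \<le> convpow F n k"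
      "summable (\<lambda>k. norm (coeff_seq (convpow F n) k))"
      "\<And>x. fser (coeff_seq (convpow F n)) x = fser (coeff_seq F) x ^ n"
    by blast+
  show ?case
    using conv_fser[OF F'(3,2,4) G(1-3)] conv_negative[OF F'(3) G(1)] G(4) by simp
qed

section \<open>Aperiodicity and the modulus of the transform\<close>

lemma conv_delta: "conv (delta m) F k = F (k - m)"
proof -
  have "conv (delta m) F k = infsum (\<lambda>j. delta m j * F (k - j)) {m}"
    unfolding conv_def by (intro infsum_cong_neutral) (auto simp: delta_def)
  then show ?thesis by (simp add: delta_def)
qed

text \<open>This is the equality case of the triangle inequality. Where the modulus is 1, all phases
  on the support agree, so a translate of the support lies in the group of integers \<open>m\<close>
  with \<open>cis (m x) = 1\<close>. Aperiodicity puts 1 into that group, and \<open>x\<close> would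
  be a multiple of 2 pi. The range includes |x| \<le> pi + 1, where the bound is applied.\<close>

lemma norm_fser_less_1:
  assumes F: "prob_Zplus F" "aperiodic F" and x: "x \<noteq> 0" "\<bar>x\<bar> < 2 * pi"
  shows "norm (fser (coeff_seq F) x) < 1"
proof (rule ccontr)
  note F' = prob_Zplus_sums[OF F(1)]
  define w where "w = fser (coeff_seq F) x"
  assume "\<not> norm (fser (coeff_seq F) x) < 1"
  moreover have "norm (fser (coeff_seq F) x) \<le> 1"
    unfolding fser_def
    by (rule norm_sums_le[OF fser_sums[OF F'(4), unfolded fser_def] F'(1)])
       (use F'(2) in \<open>simp add: norm_mult\<close>)
  ultimately have w: "norm w = 1" by (simp add: w_def)
  \<comment> \<open>Rotation by \<open>cnj w\<close> makes the series sum to 1, the total mass. The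
    deficits \<open>F k * (1 - Re (?t k))\<close> are nonnegative with sum 0, so each of them
    vanishes.\<close>
  let ?t = "\<lambda>k. cnj w * cis (- (real k * x))"
  have Re_le: "Re (?t k) \<le> 1" for k
    using complex_Re_le_cmod[of "?t k"] w by (simp add: norm_mult)
  have "(\<lambda>k. cnj w * (coeff_seq F k * cis (- (real k * x)))) sums (cnj w * w)"
    unfolding w_def by (intro sums_mult fser_sums F'(4))
  moreover have "cnj w * w = 1" using complex_norm_square[of w] w by (simp add: mult.commute)
  ultimately have "(\<lambda>k. Re (cnj w * (coeff_seq F k * cis (- (real k * x))))) sums 1"
    using sums_Re by fastforce
  moreover have "Re (cnj w * (coeff_seq F k * cis (- (real k * x)))) = F (int k) * Re (?t k)" for k
    by (simp add: algebra_simps)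
  ultimately have "(\<lambda>k. F (int k) - F (int k) * Re (?t k)) sums (1 - 1)"
    using F'(1) by (intro sums_diff) simp_all
  moreover have "0 \<le> F (int k) - F (int k) * Re (?t k)" for k
    using F'(2)[of "int k"] Re_le[of k] mult_left_mono[of "Re (?t k)" 1 "F (int k)"] by simp
  ultimately have zero: "F (int k) - F (int k) * Re (?t k) = 0" for k
    using suminf_eq_zero_iff[of "\<lambda>k. F (int k) - F (int k) * Re (?t k)"] by (simp add: sums_iff)
  have cis_eq: "cis (- (real k * x)) = w" if "F (int k) \<noteq> 0" for k
  proof -
    have "F (int k) * (1 - Re (?t k)) = 0" using zero[of k] by (simp add: algebra_simps)
    then have re: "Re (?t k) = 1" using that by simp
    have "(norm (?t k))\<^sup>2 = 1" using w by (simp add: norm_mult)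
    then have "Im (?t k) = 0" using re by (simp only: cmod_power2) simp
    then have "?t k = 1" using re by (simp add: complex_eq_iff)
    then have "w * ?t k = w" by simp
    moreover have "w * cnj w = 1" using \<open>cnj w * w = 1\<close> by (simp add: mult.commute)
    ultimately show ?thesis by (simp add: mult.assoc[symmetric])
  qed
  obtain k0 where k0: "F (int k0) \<noteq> 0"
    using F'(1) by (metis sums_0 sums_unique2 zero_neq_one)
  define H where "H = {m::int. cis (of_int m * x) = 1}"
  have "int_subgroup H"
  proof -
    have "cis (of_int (m - n) * x) = cis (of_int m * x) / cis (of_int n * x)" for m n
      by (simp add: cis_divide algebra_simps)
    then show ?thesis by (auto simp: int_subgroup_def H_def)
  qed
  moreover have "supp (conv (delta (- int k0)) F) \<subseteq> H"
  proof
    fix m assume "m \<in> supp (conv (delta (- int k0)) F)"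
    then have m: "F (m + int k0) \<noteq> 0" by (simp add: supp_def conv_delta)
    then have "0 \<le> m + int k0" using F'(3) by force
    then obtain k where k: "m + int k0 = int k" using nonneg_int_cases by blast
    then have mk: "m = int k - int k0" by simp
    have "cis (of_int m * x) = cis (- (real k0 * x)) / cis (- (real k * x))"
      by (simp add: cis_divide mk algebra_simps)
    also have "\<dots> = 1" using cis_eq[of k] cis_eq[OF k0] m k w by auto
    finally show "m \<in> H" by (simp add: H_def)
  qed
  ultimately have "gen_subgroup (supp (conv (delta (- int k0)) F)) \<subseteq> H"
    by (auto simp: gen_subgroup_def)
  then have "1 \<in> H" using F(2) by (auto simp: aperiodic_def adapted_def)
  then have "cos x = 1" by (simp add: H_def complex_eq_iff)
  then obtain n :: int where n: "x = of_int n * 2 * pi" using cos_one_2pi_int[of x] by auto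
  have "\<bar>of_int n * (2 * pi)\<bar> < 1 * (2 * pi)" using x n by (simp add: mult.assoc)
  then have "\<bar>real_of_int n\<bar> < 1" by (simp add: abs_mult)
  then have "n = 0" by linarith
  then show False using n x by simp
qed

section \<open>Decay of the transform\<close>

lemma has_vector_derivative_fser_2pi:
  assumes "(fser a has_vector_derivative d) (at y)" "x = y + 2 * pi \<or> x = y - 2 * pi"
  shows "(fser a has_vector_derivative d) (at x)"
proof -
  define t where "t = y - x"
  have per: "fser a (z + t) = fser a z" for z
    using assms(2) fser_2pi[of a z] fser_2pi[of a "z - 2 * pi"] by (auto simp: t_def)
  have "((\<lambda>z. z + t) has_vector_derivative 1) (at x)"
    by (auto intro!: derivative_eq_intros)
  moreover have "(fser a has_vector_derivative d) (at (x + t))" using assms(1) by (simp add: t_def)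
  ultimately have "(fser a \<circ> (\<lambda>z. z + t) has_vector_derivative (1 *\<^sub>R d)) (at x)"
    by (rule vector_diff_chain_at)
  then show ?thesis by (simp add: o_def per)
qed

text \<open>Beyond \<open>pi\<close>, the bound is taken at the representative \<open>y\<close> of
  \<open>x\<close> modulo 2 pi. Moving from |y| back to |x| costs 2^(1 - \<alpha>), at most
  2.\<close>

lemma fser_derivative_bound_extend:
  assumes \<alpha>: "0 < \<alpha>" "\<alpha> < 1" and "0 < c"
    and der: "\<And>x. x \<noteq> 0 \<Longrightarrow> \<bar>x\<bar> \<le> pi \<Longrightarrow> fser a differentiable (at x) \<and>
        norm (vector_derivative (fser a) (at x)) \<le> c * \<bar>x\<bar> powr (\<alpha> - 1)"
    and x: "x \<noteq> 0" "\<bar>x\<bar> \<le> pi + 1"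
  shows "fser a differentiable (at x) \<and>
        norm (vector_derivative (fser a) (at x)) \<le> 2 * c * \<bar>x\<bar> powr (\<alpha> - 1)"
proof -
  \<comment> \<open>If |x| exceeds \<open>pi\<close>, then |y| = 2 pi - |x|, and |y| \<ge> |x| / 2
    amounts to |x| \<le> 4 pi / 3. This holds up to \<open>pi + 1\<close> because pi > 3.\<close>
  obtain y where y: "x = y \<or> x = y + 2 * pi \<or> x = y - 2 * pi" "\<bar>x\<bar> / 2 \<le> \<bar>y\<bar>" "\<bar>y\<bar> \<le> pi"
  proof (cases "\<bar>x\<bar> \<le> pi")
    case True
    then show ?thesis using that[of x] by simp
  next
    case False
    show ?thesis
    proof (cases "x > 0")
      case True
      then show ?thesis using that[of "x - 2 * pi"] False x pi_gt3 by (auto simp: abs_if split: if_splits)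
    next
      case neg: False
      then show ?thesis using that[of "x + 2 * pi"] False x pi_gt3 by (auto simp: abs_if split: if_splits)
    qed
  qed
  then have "y \<noteq> 0" using x by auto
  define d where "d = vector_derivative (fser a) (at y)"
  have "(fser a has_vector_derivative d) (at y)" and d: "norm d \<le> c * \<bar>y\<bar> powr (\<alpha> - 1)"
    using der[OF \<open>y \<noteq> 0\<close> y(3)] by (auto simp: d_def vector_derivative_works)
  then have dx: "(fser a has_vector_derivative d) (at x)"
    using y(1) has_vector_derivative_fser_2pi by blast
  have "\<bar>y\<bar> powr (\<alpha> - 1) \<le> (\<bar>x\<bar> / 2) powr (\<alpha> - 1)"
    using y x \<alpha> by (intro powr_mono2') auto
  also have "\<dots> = \<bar>x\<bar> powr (\<alpha> - 1) * 2 powr (1 - \<alpha>)"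
    by (simp add: powr_divide powr_diff field_simps)
  also have "\<dots> \<le> \<bar>x\<bar> powr (\<alpha> - 1) * 2 powr 1"
    using \<alpha> by (intro mult_left_mono powr_mono) auto
  finally have "c * \<bar>y\<bar> powr (\<alpha> - 1) \<le> 2 * c * \<bar>x\<bar> powr (\<alpha> - 1)"
    using \<open>0 < c\<close> by simp
  then show ?thesis
    using dx d by (auto simp: vector_derivative_at intro: differentiableI_vector)
qed

text \<open>The singular derivative bound is integrable since \<open>\<alpha> > 0\<close>, with
  primitive c/\<alpha> times x^\<alpha>. Absolute convergence supplies continuity at 0, and
  conjugation symmetry of real coefficients covers negative \<open>x\<close>.\<close>

lemma fser_modulus_at_0:
  assumes "0 < \<alpha>" and sm: "summable (\<lambda>k. norm (complex_of_real (u k)))"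
    and der: "\<And>x. x \<noteq> 0 \<Longrightarrow> \<bar>x\<bar> \<le> R \<Longrightarrow> fser (\<lambda>k. of_real (u k)) differentiable (at x) \<and>
        norm (vector_derivative (fser (\<lambda>k. of_real (u k))) (at x)) \<le> c * \<bar>x\<bar> powr (\<alpha> - 1)"
    and x: "\<bar>x\<bar> \<le> R"
  shows "norm (fser (\<lambda>k. of_real (u k)) 0 - fser (\<lambda>k. of_real (u k)) x) \<le> c / \<alpha> * \<bar>x\<bar> powr \<alpha>"
proof -
  let ?f = "fser (\<lambda>k. of_real (u k))"
  have pos: "norm (?f x - ?f 0) \<le> c / \<alpha> * x powr \<alpha>" if "0 < x" "x \<le> R" for x
  proof -
    have "norm (?f x - ?f 0) \<le> c / \<alpha> * x powr \<alpha> - c / \<alpha> * 0 powr \<alpha>"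
    proof (rule differentiable_bound_general[OF that(1), where f' = "\<lambda>y. vector_derivative ?f (at y)"])
      show "continuous_on {0..x} ?f" by (rule continuous_on_fser[OF sm])
      show "continuous_on {0..x} (\<lambda>y. c / \<alpha> * y powr \<alpha>)"
        using \<open>0 < \<alpha>\<close> by (intro continuous_intros continuous_on_powr') auto
      fix y assume y: "0 < y" "y < x"
      show "(?f has_vector_derivative vector_derivative ?f (at y)) (at y)"
        using der[of y] y that by (auto simp: vector_derivative_works)
      have "((\<lambda>y. c / \<alpha> * y powr \<alpha>) has_real_derivative (c / \<alpha> * (\<alpha> * y powr (\<alpha> - 1)))) (at y)"
        using y by (intro DERIV_cmult has_real_derivative_powr)
      then show "((\<lambda>y. c / \<alpha> * y powr \<alpha>) has_vector_derivative c * y powr (\<alpha> - 1)) (at y)"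
        using \<open>0 < \<alpha>\<close> by (simp add: has_real_derivative_iff_has_vector_derivative)
      show "norm (vector_derivative ?f (at y)) \<le> c * y powr (\<alpha> - 1)"
        using der[of y] y that by auto
    qed
    then show ?thesis using \<open>0 < \<alpha>\<close> by simp
  qed
  consider "x = 0" | "0 < x" | "x < 0" by linarith
  then show ?thesis
  proof cases
    case 2
    then show ?thesis using pos[of x] x by (simp add: norm_minus_commute)
  next
    case 3
    have "?f 0 - ?f x = cnj (?f 0 - ?f (- x))"
      using fser_of_real_uminus[OF sm, of "- x"] fser_of_real_uminus[OF sm, of 0] by simp
    then have "norm (?f 0 - ?f x) = norm (?f 0 - ?f (- x))" by (simp only: complex_mod_cnj)
    then show ?thesis using pos[of "- x"] x 3 by (simp add: norm_minus_commute)
  qed simp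
qed

text \<open>The exponential decay joins two regimes: near 0 the identity |\<phi>|^2 = 1 - 2(1 - Re
  \<phi>) + |1 - \<phi>|^2 with the assumed lower bound, and elsewhere compactness with
  \<open>norm_fser_less_1\<close>.\<close>

lemma hypI_estimates:
  assumes \<alpha>: "0 < \<alpha>" "\<alpha> < 1" and F: "hypI \<alpha> F"
  obtains b C where "0 < b" "0 < C"
    "\<And>x. x \<noteq> 0 \<Longrightarrow> \<bar>x\<bar> \<le> pi + 1 \<Longrightarrow> fser (coeff_seq F) differentiable (at x) \<and>
       norm (vector_derivative (fser (coeff_seq F)) (at x)) \<le> C * \<bar>x\<bar> powr (\<alpha> - 1)"
    "\<And>x. \<bar>x\<bar> \<le> pi + 1 \<Longrightarrow> norm (1 - fser (coeff_seq F) x) \<le> C * \<bar>x\<bar> powr \<alpha>"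
    "\<And>x. \<bar>x\<bar> \<le> pi + 1 \<Longrightarrow> norm (fser (coeff_seq F) x) \<le> exp (- (b * \<bar>x\<bar> powr \<alpha>))"
proof -
  let ?\<phi> = "fser (coeff_seq F)"
  have prob: "prob_Zplus F" and ap: "aperiodic F" using F by (auto simp: hypI_def)
  note F' = prob_Zplus_sums[OF prob]
  obtain \<epsilon> c where ec: "0 < \<epsilon>" "\<epsilon> < 1" "0 < c"
    and lower: "\<And>x. \<bar>x\<bar> \<le> \<epsilon> \<Longrightarrow> 1 - Re (?\<phi> x) \<ge> \<epsilon> * \<bar>x\<bar> powr \<alpha>"
    and der0: "\<And>x. x \<noteq> 0 \<Longrightarrow> \<bar>x\<bar> \<le> pi \<Longrightarrow> ?\<phi> differentiable (at x) \<and>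
       norm (vector_derivative ?\<phi> (at x)) \<le> c * \<bar>x\<bar> powr (\<alpha> - 1)"
  proof -
    from F[unfolded hypI_def fourier_prob[OF prob]] obtain \<epsilon> c where *:
      "0 < \<epsilon>" "\<epsilon> < 1" "0 < c"
      "\<forall>x\<in>{-\<epsilon>..\<epsilon>}. 1 - Re (?\<phi> x) \<ge> \<epsilon> * \<bar>x\<bar> powr \<alpha>"
      "\<forall>x\<in>{-pi..pi} - {0}. ?\<phi> differentiable (at x) \<and>
            norm (vector_derivative ?\<phi> (at x)) \<le> c * \<bar>x\<bar> powr (\<alpha> - 1)"
      by blast
    show ?thesis
      by (rule that[OF *(1-3)]) (use *(4,5) in \<open>auto simp: abs_le_iff\<close>)
  qed
  note der = fser_derivative_bound_extend[OF \<alpha> ec(3) der0]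
  have mod0: "norm (1 - ?\<phi> x) \<le> 2 * c / \<alpha> * \<bar>x\<bar> powr \<alpha>" if "\<bar>x\<bar> \<le> pi + 1" for x
    using fser_modulus_at_0[OF \<alpha>(1) F'(4) der that] by (simp add: fser_prob_0[OF prob])
  define C where "C = max (2 * c) (2 * c / \<alpha>)"
  have C: "0 < C" "2 * c \<le> C" "2 * c / \<alpha> \<le> C" using ec by (auto simp: C_def)
  have derC: "?\<phi> differentiable (at x) \<and> norm (vector_derivative ?\<phi> (at x)) \<le> C * \<bar>x\<bar> powr (\<alpha> - 1)"
    if "x \<noteq> 0" "\<bar>x\<bar> \<le> pi + 1" for x
    using der[OF _ _ that] mult_right_mono[OF C(2), of "\<bar>x\<bar> powr (\<alpha> - 1)"] by auto
  have modC: "norm (1 - ?\<phi> x) \<le> C * \<bar>x\<bar> powr \<alpha>" if "\<bar>x\<bar> \<le> pi + 1" for x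
    using mod0[OF that] mult_right_mono[OF C(3), of "\<bar>x\<bar> powr \<alpha>"] by auto
  \<comment> \<open>For |x| \<le> \<delta> the quadratic term C^2 |x|^(2\<alpha>) is at most
    \<epsilon> |x|^\<alpha>, half of the linear gain.\<close>
  define \<delta> where "\<delta> = min \<epsilon> ((\<epsilon> / C\<^sup>2) powr (1 / \<alpha>))"
  have \<delta>: "0 < \<delta>" "\<delta> \<le> \<epsilon>" using ec C by (auto simp: \<delta>_def)
  have near: "norm (?\<phi> x) \<le> exp (- (\<epsilon> / 2 * \<bar>x\<bar> powr \<alpha>))" if "\<bar>x\<bar> \<le> \<delta>" for x
  proof -
    let ?t = "\<bar>x\<bar> powr \<alpha>"
    have "?t \<le> ((\<epsilon> / C\<^sup>2) powr (1 / \<alpha>)) powr \<alpha>"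
      using that \<alpha> by (intro powr_mono2) (auto simp: \<delta>_def)
    also have "\<dots> = \<epsilon> / C\<^sup>2" using \<alpha> ec C by (simp add: powr_powr)
    finally have t: "C\<^sup>2 * ?t \<le> \<epsilon>" using C by (simp add: field_simps)
    have "(norm (?\<phi> x))\<^sup>2 = 1 - 2 * (1 - Re (?\<phi> x)) + (norm (1 - ?\<phi> x))\<^sup>2"
      by (simp add: cmod_power2 power2_diff)
    also have "\<dots> \<le> 1 - 2 * (\<epsilon> * ?t) + (C * ?t)\<^sup>2"
      using lower[of x] modC[of x] that \<delta> ec pi_gt3
      by (intro add_mono diff_mono mult_left_mono power_mono) auto
    also have "(C * ?t)\<^sup>2 = (C\<^sup>2 * ?t) * ?t" by (simp add: power2_eq_square)
    also have "\<dots> \<le> \<epsilon> * ?t" using t by (intro mult_right_mono) auto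
    finally have "(norm (?\<phi> x))\<^sup>2 \<le> 1 + (- (\<epsilon> * ?t))" by simp
    also have "\<dots> \<le> exp (- (\<epsilon> * ?t))" by (rule exp_ge_add_one_self)
    also have "\<dots> = (exp (- (\<epsilon> / 2 * ?t)))\<^sup>2" by (simp add: exp_double[symmetric])
    finally show ?thesis by (rule power2_le_imp_le) simp
  qed
  obtain M where M: "0 < M" "M < 1" "\<And>x. \<delta> \<le> \<bar>x\<bar> \<Longrightarrow> \<bar>x\<bar> \<le> pi + 1 \<Longrightarrow> norm (?\<phi> x) \<le> M"
  proof -
    let ?S = "{-(pi + 1)..-\<delta>} \<union> {\<delta>..pi + 1}"
    have "\<delta> \<le> pi + 1" using \<delta> ec pi_gt3 by linarith
    then have ne: "?S \<noteq> {}" by auto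
    have "compact ?S" by (intro compact_Un compact_Icc)
    moreover have "continuous_on ?S (\<lambda>x. norm (?\<phi> x))"
      by (intro continuous_intros continuous_on_fser F'(4))
    ultimately obtain y where y: "y \<in> ?S" "\<And>x. x \<in> ?S \<Longrightarrow> norm (?\<phi> x) \<le> norm (?\<phi> y)"
      using continuous_attains_sup[of ?S "\<lambda>x. norm (?\<phi> x)"] ne by blast
    have "norm (?\<phi> y) < 1"
      using y(1) \<delta> pi_gt3 by (intro norm_fser_less_1[OF prob ap]) auto
    moreover have "norm (?\<phi> x) \<le> norm (?\<phi> y)" if "\<delta> \<le> \<bar>x\<bar>" "\<bar>x\<bar> \<le> pi + 1" for x
      using that by (intro y(2)) auto
    \<comment> \<open>The maximum with 1/2 keeps \<open>M\<close> positive, as \<open>ln M\<close>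
      is taken below.\<close>
    ultimately show ?thesis using that[of "max (1/2) (norm (?\<phi> y))"] by force
  qed
  define L where "L = (pi + 1) powr \<alpha>"
  have L: "0 < L" using pi_gt3 by (simp add: L_def)
  \<comment> \<open>\<open>L\<close> is the largest value of |x|^\<alpha> on the range, so the
    second entry ensures M \<le> exp (-b |x|^\<alpha>) away from 0.\<close>
  define b where "b = min (\<epsilon> / 2) (- ln M / L)"
  have "ln M < 0" using M by simp
  then have b: "0 < b" using ec L by (auto simp: b_def divide_less_0_iff)
  have b2: "b \<le> \<epsilon> / 2" and b3: "b \<le> - ln M / L" unfolding b_def by (rule min.cobounded1 min.cobounded2)+
  have "norm (?\<phi> x) \<le> exp (- (b * \<bar>x\<bar> powr \<alpha>))" if x: "\<bar>x\<bar> \<le> pi + 1" for x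
  proof (cases "\<bar>x\<bar> \<le> \<delta>")
    case True
    have "b * \<bar>x\<bar> powr \<alpha> \<le> \<epsilon> / 2 * \<bar>x\<bar> powr \<alpha>" using b2 by (intro mult_right_mono) auto
    then show ?thesis using near[OF True] by (smt (verit) exp_le_cancel_iff)
  next
    case False
    have "b * \<bar>x\<bar> powr \<alpha> \<le> b * L"
      using b x \<alpha> unfolding L_def by (intro mult_left_mono powr_mono2) auto
    also have "\<dots> \<le> - ln M" using b3 unfolding pos_le_divide_eq[OF L] .
    finally have "exp (ln M) \<le> exp (- (b * \<bar>x\<bar> powr \<alpha>))" by simp
    then show ?thesis using M(3)[of x] False x M(1) by simp
  qed
  then show ?thesis using that[OF b C(1) derC modC] by blast
qed

text \<open>This is the inequality u \<le> exp u at u = bs/p, raised to the power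
  \<open>p\<close>.\<close>

lemma powr_mult_exp_le:
  fixes s :: real
  assumes "0 < p" "0 < b" "0 \<le> s"
  shows "s powr p * exp (- (b * s)) \<le> (p / b) powr p"
proof -
  have "b * s / p \<le> exp (b * s / p)" using exp_ge_add_one_self[of "b * s / p"] by linarith
  then have "(b * s / p) powr p \<le> exp (b * s / p) powr p"
    using assms by (intro powr_mono2) auto
  also have "\<dots> = exp (b * s)" using assms by (simp add: powr_def)
  finally have "(p / b) powr p * (b * s / p) powr p \<le> (p / b) powr p * exp (b * s)"
    by (intro mult_left_mono) auto
  also have "(p / b) powr p * (b * s / p) powr p = s powr p"
    using assms by (subst powr_mult[symmetric]) auto
  finally show ?thesis by (simp add: exp_minus field_simps)
qed

section \<open>Membership in the class and perturbation\<close>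

text \<open>Identifies the sum in \<open>classA\<close> with the series of absolute coefficients
  that \<open>fser_l1_bound\<close> controls.\<close>

lemma convpow_diff_l1:
  assumes F: "prob_Zplus F"
  shows "((\<lambda>k. \<bar>convpow F n k - convpow F (Suc n) k\<bar>) has_sum
      (\<Sum>k. norm (coeff_seq (convpow F n) k - coeff_seq (convpow F (Suc n)) k))) UNIV"
    "summable (\<lambda>k. norm (coeff_seq (convpow F n) k - coeff_seq (convpow F (Suc n)) k))"
proof -
  note c = convpow_fser[OF F, of n] convpow_fser[OF F, of "Suc n"]
  let ?d = "\<lambda>k. coeff_seq (convpow F n) k - coeff_seq (convpow F (Suc n)) k"
  show sm: "summable (\<lambda>k. norm (?d k))"
    by (rule summable_comparison_test'[OF summable_add[of "\<lambda>k. norm (coeff_seq (convpow F n) k)"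
          "\<lambda>k. norm (coeff_seq (convpow F (Suc n)) k)"]])
       (use c norm_triangle_ineq4 in \<open>simp_all del: convpow.simps norm_of_real\<close>)
  have eq: "norm (?d k) = \<bar>convpow F n (int k) - convpow F (Suc n) (int k)\<bar>" for k
    by (simp only: of_real_diff[symmetric] norm_of_real)
  have neg: "\<forall>k<0. \<bar>convpow F n k - convpow F (Suc n) k\<bar> = 0"
    using c by (simp del: convpow.simps)
  have "((\<lambda>k. norm (?d k)) has_sum (\<Sum>k. norm (?d k))) UNIV"
    by (rule sums_nonneg_imp_has_sum[OF summable_sums[OF sm]]) simp
  then show "((\<lambda>k. \<bar>convpow F n k - convpow F (Suc n) k\<bar>) has_sum (\<Sum>k. norm (?d k))) UNIV"
    unfolding has_sum_int_nat[OF neg] by (simp only: eq)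
qed

text \<open>In the variable s = n |x|^\<alpha> one has N |x| = s^(1/\<alpha>) and (N |x|)^\<beta> =
  s^(1/2), so all four bounds required by \<open>fser_l1_bound\<close> reduce to boundedness of s^p
  exp (-b s) for a few exponents \<open>p\<close>.\<close>

lemma hypI_imp_classA:
  assumes \<alpha>: "0 < \<alpha>" "\<alpha> < 1" and F: "hypI \<alpha> F"
  shows "F \<in> classA"
proof -
  let ?\<phi> = "fser (coeff_seq F)"
  have prob: "prob_Zplus F" using F by (simp add: hypI_def)
  obtain b C where b: "0 < b" and C: "0 < C"
    and der: "\<And>x. x \<noteq> 0 \<Longrightarrow> \<bar>x\<bar> \<le> pi + 1 \<Longrightarrow> ?\<phi> differentiable (at x) \<and>
       norm (vector_derivative ?\<phi> (at x)) \<le> C * \<bar>x\<bar> powr (\<alpha> - 1)"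
    and mod0: "\<And>x. \<bar>x\<bar> \<le> pi + 1 \<Longrightarrow> norm (1 - ?\<phi> x) \<le> C * \<bar>x\<bar> powr \<alpha>"
    and decay: "\<And>x. \<bar>x\<bar> \<le> pi + 1 \<Longrightarrow> norm (?\<phi> x) \<le> exp (- (b * \<bar>x\<bar> powr \<alpha>))"
    using hypI_estimates[OF \<alpha> F] by blast
  define \<beta> where "\<beta> = \<alpha> / 2"
  have \<beta>: "0 < \<beta>" "\<beta> < 1 / 2" using \<alpha> by (auto simp: \<beta>_def)
  obtain C1 where C1: "0 < C1" and l1: "\<And>a N K. \<lbrakk>summable (\<lambda>k. norm (a k)); 1 \<le> N; 0 \<le> K;
        \<And>x. \<bar>x\<bar> \<le> pi + 1 \<Longrightarrow> norm (fser a x) \<le> K;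
        \<And>x. x \<noteq> 0 \<Longrightarrow> \<bar>x\<bar> \<le> pi + 1 \<Longrightarrow> norm (fser a x) \<le> K / (N * \<bar>x\<bar>);
        \<And>x. \<bar>x\<bar> \<le> pi + 1 \<Longrightarrow> norm (fser a x) \<le> K * (N * \<bar>x\<bar>) powr \<beta>;
        \<And>x. x \<noteq> 0 \<Longrightarrow> \<bar>x\<bar> \<le> pi + 1 \<Longrightarrow> fser a differentiable (at x) \<and>
          norm (vector_derivative (fser a) (at x)) \<le> K * (N * \<bar>x\<bar>) powr \<beta> / \<bar>x\<bar>\<rbrakk>
      \<Longrightarrow> (\<Sum>k. norm (a k)) \<le> C1 * K"
    using fser_l1_bound[OF \<beta>] by metis
  \<comment> \<open>\<open>E\<close> absorbs the one decaying factor lost to the exponent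
    \<open>n - 1\<close> in the derivative, and \<open>m p\<close> bounds s^p exp (-b s). Adding the
    constants for all exponents into \<open>M\<close> lets one \<open>K\<close> serve every
    bound.\<close>
  define E where "E = exp (b * (pi + 1) powr \<alpha>)"
  define m where "m p = (p / b) powr p" for p
  define M where "M = m 1 + m (1 + 1 / \<alpha>) + m (1 / 2) + C * E * m (3 / 2)"
  have m: "0 \<le> m p" for p by (simp add: m_def)
  have E: "0 < E" by (simp add: E_def)
  have M: "0 \<le> M" "m 1 \<le> M" "m (1 + 1 / \<alpha>) \<le> M" "m (1 / 2) \<le> M" "m (1 / 2) + C * E * m (3 / 2) \<le> M"
    using m[of 1] m[of "1 + 1 / \<alpha>"] m[of "1 / 2"] mult_nonneg_nonneg[of "C * E", OF _ m[of "3 / 2"]] C E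
    by (auto simp: M_def)
  have mb: "s powr p * exp (- (b * s)) \<le> m p" if "0 < p" "0 \<le> s" for s p
    unfolding m_def using that b by (intro powr_mult_exp_le) auto
  have b1: "s * exp (- (b * s)) \<le> M" if "0 \<le> s" for s
    using mb[of 1 s] M(2) that by simp
  have b2: "s * exp (- (b * s)) \<le> M / s powr (1 / \<alpha>)" if "0 < s" for s
  proof -
    have "(s * exp (- (b * s))) * s powr (1 / \<alpha>) = s powr (1 + 1 / \<alpha>) * exp (- (b * s))"
      using that by (simp add: powr_add)
    also have "\<dots> \<le> M"
      by (rule order_trans[OF mb M(3)]) (use that \<alpha> in \<open>auto intro: add_pos_pos\<close>)
    finally show ?thesis using that by (simp add: pos_le_divide_eq)
  qed
  have half: "s = s powr (1 / 2) * s powr (1 / 2)" "s * s = s powr (1 / 2) * s powr (3 / 2)"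
    if "0 \<le> s" for s :: real
    using that by (auto simp: powr_add[symmetric] power2_eq_square)
  have b3: "s * exp (- (b * s)) \<le> M * s powr (1 / 2)" if "0 \<le> s" for s
  proof -
    have "s * exp (- (b * s)) = s powr (1 / 2) * (s powr (1 / 2) * exp (- (b * s)))"
      by (subst half(1)[OF that]) simp
    also have "\<dots> \<le> s powr (1 / 2) * M"
      using mb[of "1 / 2" s] M(4) that by (intro mult_left_mono) auto
    finally show ?thesis by (simp add: mult.commute)
  qed
  have b4: "s * (C * E * s + 1) * exp (- (b * s)) \<le> M * s powr (1 / 2)" if "0 \<le> s" for s
  proof -
    have "s * (C * E * s + 1) * exp (- (b * s)) = (C * E * (s * s) + s) * exp (- (b * s))"
      by (simp add: algebra_simps)
    also have "\<dots> = (C * E * (s powr (1 / 2) * s powr (3 / 2)) + s powr (1 / 2) * s powr (1 / 2)) * exp (- (b * s))"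
      using half[OF that] by simp
    also have "\<dots> = s powr (1 / 2) * (C * E * (s powr (3 / 2) * exp (- (b * s))) + s powr (1 / 2) * exp (- (b * s)))"
      by (simp only: algebra_simps)
    also have "\<dots> \<le> s powr (1 / 2) * (C * E * m (3 / 2) + m (1 / 2))"
      using that C E by (intro mult_left_mono add_mono mb) auto
    also have "\<dots> \<le> s powr (1 / 2) * M"
      using M(5) by (intro mult_left_mono) auto
    finally show ?thesis by (simp add: mult.commute)
  qed
  have bound: "real n * (\<Sum>k. norm (coeff_seq (convpow F n) k - coeff_seq (convpow F (Suc n)) k)) \<le> C1 * (C * M)"
    if "0 < n" for n
  proof -
    define a where "a k = coeff_seq (convpow F n) k - coeff_seq (convpow F (Suc n)) k" for k
    define N where "N = real n powr (1 / \<alpha>)"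
    define K where "K = C * M / real n"
    have fs: "fser a = (\<lambda>x. ?\<phi> x ^ n * (1 - ?\<phi> x))"
    proof
      fix x
      note c = convpow_fser[OF prob, of n] convpow_fser[OF prob, of "Suc n"]
      have "fser a x = fser (coeff_seq (convpow F n)) x - fser (coeff_seq (convpow F (Suc n))) x"
        unfolding a_def[abs_def] using c by (intro fser_diff) blast+
      also have "\<dots> = ?\<phi> x ^ n - ?\<phi> x ^ Suc n" using c by metis
      finally show "fser a x = ?\<phi> x ^ n * (1 - ?\<phi> x)" by (simp add: algebra_simps)
    qed
    have s_powr: "N * \<bar>x\<bar> = (real n * \<bar>x\<bar> powr \<alpha>) powr (1 / \<alpha>)" for x
      using \<alpha> by (simp add: N_def powr_mult powr_powr)
    have s_half: "(N * \<bar>x\<bar>) powr \<beta> = (real n * \<bar>x\<bar> powr \<alpha>) powr (1 / 2)" for x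
      using \<alpha> unfolding s_powr by (simp add: powr_powr \<beta>_def)
    have main: "norm (fser a x) \<le> C / real n * (real n * \<bar>x\<bar> powr \<alpha> * exp (- (b * (real n * \<bar>x\<bar> powr \<alpha>))))"
      if "\<bar>x\<bar> \<le> pi + 1" for x
    proof -
      have "norm (fser a x) = norm (?\<phi> x) ^ n * norm (1 - ?\<phi> x)"
        by (simp add: fs norm_mult norm_power)
      also have "\<dots> \<le> exp (- (b * \<bar>x\<bar> powr \<alpha>)) ^ n * (C * \<bar>x\<bar> powr \<alpha>)"
        using decay[OF that] mod0[OF that] by (intro mult_mono power_mono) auto
      also have "exp (- (b * \<bar>x\<bar> powr \<alpha>)) ^ n = exp (- (b * (real n * \<bar>x\<bar> powr \<alpha>)))"
        by (simp add: exp_of_nat_mult[symmetric] mult_ac)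
      finally show ?thesis using \<open>0 < n\<close> by (simp add: mult_ac)
    qed
    have "(\<Sum>k. norm (a k)) \<le> C1 * K"
    proof (rule l1)
      show "summable (\<lambda>k. norm (a k))" unfolding a_def by (rule convpow_diff_l1(2)[OF prob])
      show "1 \<le> N" using \<open>0 < n\<close> \<alpha> by (simp add: N_def ge_one_powr_ge_zero)
      show "0 \<le> K" using C M by (simp add: K_def)
      have Cn: "0 \<le> C / real n" using C by simp
      fix x :: real assume x: "\<bar>x\<bar> \<le> pi + 1"
      define s where "s = real n * \<bar>x\<bar> powr \<alpha>"
      have s: "0 \<le> s" by (simp add: s_def)
      note main' = order_trans[OF main[OF x, folded s_def] mult_left_mono[OF _ Cn]]
      show "norm (fser a x) \<le> K"
        using main'[OF b1[OF s]] by (simp add: K_def)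
      show "norm (fser a x) \<le> K * (N * \<bar>x\<bar>) powr \<beta>"
        using main'[OF b3[OF s]] by (simp add: K_def s_half s_def)
      assume x0: "x \<noteq> 0"
      then have s0: "0 < s" using \<open>0 < n\<close> by (simp add: s_def)
      show "norm (fser a x) \<le> K / (N * \<bar>x\<bar>)"
        using main'[OF b2[OF s0]] by (simp add: K_def s_powr s_def)
      define d where "d = vector_derivative ?\<phi> (at x)"
      have d: "(?\<phi> has_vector_derivative d) (at x)" and nd: "norm d \<le> C * \<bar>x\<bar> powr (\<alpha> - 1)"
        using der[OF x0 x] by (auto simp: d_def vector_derivative_works)
      have "((\<lambda>z. z ^ n * (1 - z)) has_field_derivative
          (of_nat n * ?\<phi> x ^ (n - 1) * (1 - ?\<phi> x) - ?\<phi> x ^ n)) (at (?\<phi> x))"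
        by (auto intro!: derivative_eq_intros)
      from field_vector_diff_chain_at[OF d this]
      have D: "(fser a has_vector_derivative
           (d * (of_nat n * ?\<phi> x ^ (n - 1) * (1 - ?\<phi> x) - ?\<phi> x ^ n))) (at x)"
        by (simp add: fs o_def)
      have "norm (d * (of_nat n * ?\<phi> x ^ (n - 1) * (1 - ?\<phi> x) - ?\<phi> x ^ n))
          \<le> norm d * (real n * norm (?\<phi> x) ^ (n - 1) * norm (1 - ?\<phi> x) + norm (?\<phi> x) ^ n)"
        unfolding norm_mult
        by (intro mult_left_mono order_trans[OF norm_triangle_ineq4]) (auto simp: norm_mult norm_power)
      also have "\<dots> \<le> (C * \<bar>x\<bar> powr (\<alpha> - 1)) *
          (real n * (exp (- (b * s)) * E) * (C * \<bar>x\<bar> powr \<alpha>) + exp (- (b * s)))"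
      proof -
        have p: "norm (?\<phi> x) ^ n \<le> exp (- (b * s))"
        proof -
          have "norm (?\<phi> x) ^ n \<le> exp (- (b * \<bar>x\<bar> powr \<alpha>)) ^ n"
            using decay[OF x] by (intro power_mono) auto
          then show ?thesis by (simp add: exp_of_nat_mult[symmetric] mult_ac s_def)
        qed
        have "norm (?\<phi> x) ^ (n - 1) \<le> exp (- (b * \<bar>x\<bar> powr \<alpha>)) ^ (n - 1)"
          using decay[OF x] by (intro power_mono) auto
        \<comment> \<open>Relative to the full exponent \<open>n\<close>, the missing factor costs
          exp (b |x|^\<alpha>), which is at most \<open>E\<close> on the range.\<close>
        also have "\<dots> = exp (- (b * s)) * exp (b * \<bar>x\<bar> powr \<alpha>)"
          using \<open>0 < n\<close>
          by (simp add: exp_of_nat_mult[symmetric] exp_add[symmetric] of_nat_diff algebra_simps s_def)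
        also have "\<dots> \<le> exp (- (b * s)) * E"
          using b x \<alpha> by (auto simp: E_def intro!: powr_mono2)
        finally have q: "norm (?\<phi> x) ^ (n - 1) \<le> exp (- (b * s)) * E" .
        show ?thesis
          using nd p q mod0[OF x] C E by (intro mult_mono add_mono) auto
      qed
      also have "\<dots> = (C * \<bar>x\<bar> powr (\<alpha> - 1)) * ((C * E * s + 1) * exp (- (b * s)))"
        by (simp add: s_def algebra_simps)
      \<comment> \<open>Rewriting |x|^\<alpha> as s/n exposes the factor 1/n that makes
        \<open>K\<close> of order 1/n.\<close>
      also have "C * \<bar>x\<bar> powr (\<alpha> - 1) = C / real n * s / \<bar>x\<bar>"
        using x0 \<open>0 < n\<close> by (simp add: s_def powr_diff)
      also have "C / real n * s / \<bar>x\<bar> * ((C * E * s + 1) * exp (- (b * s)))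
          = C / real n * (s * (C * E * s + 1) * exp (- (b * s))) / \<bar>x\<bar>"
        by (simp add: mult.assoc)
      also have "\<dots> \<le> C / real n * (M * s powr (1 / 2)) / \<bar>x\<bar>"
        using Cn by (intro divide_right_mono mult_left_mono b4 s) auto
      also have "\<dots> = K * (N * \<bar>x\<bar>) powr \<beta> / \<bar>x\<bar>"
        unfolding s_half s_def[symmetric] by (simp add: K_def)
      finally show "fser a differentiable (at x) \<and>
          norm (vector_derivative (fser a) (at x)) \<le> K * (N * \<bar>x\<bar>) powr \<beta> / \<bar>x\<bar>"
        using D by (auto simp: vector_derivative_at intro: differentiableI_vector)
    qed
    then have "real n * (\<Sum>k. norm (a k)) \<le> real n * (C1 * K)" by (intro mult_left_mono) auto
    also have "\<dots> = C1 * (C * M)" using \<open>0 < n\<close> by (simp add: K_def)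
    finally show ?thesis by (simp only: a_def)
  qed
  have "real n * (\<Sum>\<^sub>\<infinity>k. \<bar>convpow F n k - convpow F (Suc n) k\<bar>) \<le> C1 * (C * M)" for n
    using bound[of n] C C1 M(1) unfolding infsumI[OF convpow_diff_l1(1)[OF prob]]
    by (cases "n = 0") simp_all
  then have "bdd_above (range (\<lambda>n. real n * (\<Sum>\<^sub>\<infinity>k. \<bar>convpow F n k - convpow F (Suc n) k\<bar>)))"
    by (intro bdd_aboveI[where M = "C1 * (C * M)"]) blast
  then show ?thesis
    using prob has_sum_imp_summable[OF convpow_diff_l1(1)[OF prob]]
    by (simp add: classA_def del: convpow.simps)
qed

text \<open>The transform of \<open>G\<close> is \<open>a\<close> times that of \<open>F\<close>
  plus \<open>fser h\<close>, which is Lipschitz because \<open>h\<close> has a finite first moment.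
  Half of the lower bound for \<open>a F\<close> is given up to absorb this term near 0.\<close>

lemma hypI_perturb:
  assumes \<alpha>: "0 < \<alpha>" "\<alpha> < 1" and F: "hypI \<alpha> F" and G: "prob_Zplus G" "aperiodic G" and "0 < a"
    and sum: "(\<lambda>k. of_int k * \<bar>G k - a * F k\<bar>) summable_on {1..}"
  shows "hypI \<alpha> G"
proof -
  have probF: "prob_Zplus F" using F by (simp add: hypI_def)
  note F' = prob_Zplus_sums[OF probF] and G' = prob_Zplus_sums[OF G(1)]
  let ?\<phi> = "fser (coeff_seq F)" and ?\<gamma> = "fser (coeff_seq G)"
  define h where "h k = coeff_seq G k - of_real a * coeff_seq F k" for k
  have smaF: "summable (\<lambda>k. norm (of_real a * coeff_seq F k))"
    using summable_mult[OF F'(4), of "\<bar>a\<bar>"] by (simp only: norm_mult norm_of_real)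
  have smh: "summable (\<lambda>k. norm (h k))"
    unfolding h_def
    by (rule summable_comparison_test'[OF summable_add[OF G'(4) smaF]])
       (use norm_triangle_ineq4 in \<open>simp del: norm_of_real\<close>)
  have gamma: "?\<gamma> x = of_real a * ?\<phi> x + fser h x" for x
    using fser_diff[OF G'(4) smaF, of x] fser_cmult[OF F'(4), of "of_real a" x] by (simp add: h_def[abs_def])
  have sm1: "summable (\<lambda>k. real k * norm (h k))"
  proof -
    let ?f = "\<lambda>k::int. of_int k * \<bar>G k - a * F k\<bar>"
    \<comment> \<open>Passing from {1..} to all integers adds nothing: the weight kills the index 0,
      and both distributions vanish below it.\<close>
    have neg: "\<forall>k<0. ?f k = 0" using F'(3) G'(3) by simp
    have "?f k = 0" if "k \<notin> {1..}" for k
    proof (cases "k = 0")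
      case False
      then show ?thesis using neg that by auto
    qed simp
    then have "?f summable_on UNIV \<longleftrightarrow> ?f summable_on {1..}"
      by (intro summable_on_cong_neutral) auto
    then obtain s where "(?f has_sum s) UNIV" using sum by (auto simp: summable_on_def)
    then have "((\<lambda>n. ?f (int n)) has_sum s) UNIV" using has_sum_int_nat[OF neg] by blast
    then have "summable (\<lambda>n. ?f (int n))" using has_sum_imp_sums sums_summable by blast
    moreover have "norm (h k) = \<bar>G (int k) - a * F (int k)\<bar>" for k
      unfolding h_def by (simp only: of_real_mult[symmetric] of_real_diff[symmetric] norm_of_real)
    ultimately show ?thesis by simp
  qed
  define L where "L = (\<Sum>k. real k * norm (h k))"
  have L: "0 \<le> L" unfolding L_def by (intro suminf_nonneg sm1) auto
  note dh = fser_has_vector_derivative[OF smh sm1, folded L_def]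
  have dh': "fser h differentiable (at x) \<and> norm (vector_derivative (fser h) (at x)) \<le> L" for x
    using dh[of x] by (auto simp: vector_derivative_at intro: differentiableI_vector)
  have lip: "norm (fser h 0 - fser h x) \<le> L * \<bar>x\<bar>" for x
  proof (cases "0 \<le> x")
    case True
    then show ?thesis
      using vector_derivative_increment_bound[of x 0 "fser h" L] dh' by (simp add: norm_minus_commute)
  next
    case False
    then show ?thesis
      using vector_derivative_increment_bound[of "- x" x "fser h" L] dh' by simp
  qed
  from F[unfolded hypI_def fourier_prob[OF probF]] obtain \<epsilon> c where ec:
      "0 < \<epsilon>" "\<epsilon> < 1" "0 < c"
      "\<forall>x\<in>{-\<epsilon>..\<epsilon>}. 1 - Re (?\<phi> x) \<ge> \<epsilon> * \<bar>x\<bar> powr \<alpha>"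
      "\<forall>x\<in>{-pi..pi} - {0}. ?\<phi> differentiable (at x) \<and>
            norm (vector_derivative ?\<phi> (at x)) \<le> c * \<bar>x\<bar> powr (\<alpha> - 1)"
    by blast
  \<comment> \<open>This makes L |x| at most (a \<epsilon> / 2) |x|^\<alpha> for |x| \<le> \<delta>;
    \<open>L + 1\<close> avoids division by zero. The entry \<open>a * \<epsilon> / 2\<close> in
    \<open>\<epsilon>'\<close> is the constant that remains.\<close>
  define \<delta> where "\<delta> = (a * \<epsilon> / (2 * (L + 1))) powr (1 / (1 - \<alpha>))"
  define \<epsilon>' where "\<epsilon>' = min \<epsilon> (min \<delta> (a * \<epsilon> / 2))"
  have "0 < \<delta>" using ec L \<open>0 < a\<close> by (auto simp: \<delta>_def)
  then have e': "0 < \<epsilon>'" "\<epsilon>' < 1" using ec \<open>0 < a\<close> by (auto simp: \<epsilon>'_def)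
  have e'': "\<epsilon>' \<le> \<epsilon>" "\<epsilon>' \<le> \<delta>" "\<epsilon>' \<le> a * \<epsilon> / 2" unfolding \<epsilon>'_def by linarith+
  have "1 - Re (?\<gamma> x) \<ge> \<epsilon>' * \<bar>x\<bar> powr \<alpha>" if x: "x \<in> {-\<epsilon>'..\<epsilon>'}" for x
  proof -
    have "L * \<bar>x\<bar> \<le> a * \<epsilon> / 2 * \<bar>x\<bar> powr \<alpha>"
    proof -
      have "\<bar>x\<bar> \<le> \<delta>" using x e'' by auto
      then have "\<bar>x\<bar> powr (1 - \<alpha>) \<le> \<delta> powr (1 - \<alpha>)" using \<alpha> by (intro powr_mono2) auto
      also have "\<dots> = a * \<epsilon> / (2 * (L + 1))"
        using \<alpha> ec L \<open>0 < a\<close> by (simp add: \<delta>_def powr_powr)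
      finally have "(L + 1) * \<bar>x\<bar> powr (1 - \<alpha>) \<le> a * \<epsilon> / 2"
        using L by (simp add: field_simps)
      moreover have "L * \<bar>x\<bar> powr (1 - \<alpha>) \<le> (L + 1) * \<bar>x\<bar> powr (1 - \<alpha>)"
        by (intro mult_right_mono) auto
      ultimately have "L * \<bar>x\<bar> powr (1 - \<alpha>) * \<bar>x\<bar> powr \<alpha> \<le> a * \<epsilon> / 2 * \<bar>x\<bar> powr \<alpha>"
        by (intro mult_right_mono) auto
      moreover have "\<bar>x\<bar> powr (1 - \<alpha>) * \<bar>x\<bar> powr \<alpha> = \<bar>x\<bar>" by (simp add: powr_add[symmetric])
      ultimately show ?thesis by (simp add: mult.assoc)
    qed
    moreover have "a * (\<epsilon> * \<bar>x\<bar> powr \<alpha>) \<le> a * (1 - Re (?\<phi> x))"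
      using ec(4) x e'' \<open>0 < a\<close> by (intro mult_left_mono) auto
    \<comment> \<open>Both transforms equal 1 at 0, so \<open>fser h 0\<close> supplies the missing
      mass 1 - a and only an increment of \<open>fser h\<close> remains.\<close>
    moreover have "1 - Re (?\<gamma> x) = a * (1 - Re (?\<phi> x)) + Re (fser h 0 - fser h x)"
    proof -
      have "1 = of_real a + fser h 0"
        using gamma[of 0] by (simp add: fser_prob_0 G(1) probF)
      then have "1 = a + Re (fser h 0)" by (metis one_complex.sel(1) plus_complex.sel(1) Re_complex_of_real)
      then show ?thesis by (simp add: gamma algebra_simps)
    qed
    moreover have "- (L * \<bar>x\<bar>) \<le> Re (fser h 0 - fser h x)"
      using lip[of x] abs_Re_le_cmod[of "fser h 0 - fser h x"] by linarith
    moreover have "\<epsilon>' * \<bar>x\<bar> powr \<alpha> \<le> a * \<epsilon> / 2 * \<bar>x\<bar> powr \<alpha>"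
      using e'' by (intro mult_right_mono) auto
    ultimately show ?thesis by (simp add: algebra_simps)
  qed
  \<comment> \<open>On [-pi, pi] the constant \<open>L\<close> is at most L pi^(1 - \<alpha>)
    |x|^(\<alpha> - 1), since \<alpha> < 1.\<close>
  moreover define c' where "c' = a * c + L * pi powr (1 - \<alpha>)"
  moreover have "?\<gamma> differentiable (at x) \<and> norm (vector_derivative ?\<gamma> (at x)) \<le> c' * \<bar>x\<bar> powr (\<alpha> - 1)"
    if x: "x \<in> {-pi..pi} - {0}" for x
  proof -
    define d where "d = vector_derivative ?\<phi> (at x)"
    define e where "e = vector_derivative (fser h) (at x)"
    have d: "(?\<phi> has_vector_derivative d) (at x)" "norm d \<le> c * \<bar>x\<bar> powr (\<alpha> - 1)"
      using ec(5) x by (auto simp: d_def vector_derivative_works)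
    have e: "(fser h has_vector_derivative e) (at x)" "norm e \<le> L"
      using dh'[of x] by (auto simp: e_def vector_derivative_works)
    have "?\<gamma> = (\<lambda>x. of_real a * ?\<phi> x + fser h x)" by (auto simp: gamma)
    then have D: "(?\<gamma> has_vector_derivative (of_real a * d + e)) (at x)"
      using has_vector_derivative_add[OF has_vector_derivative_mult_right[OF d(1), of "of_real a"] e(1)]
      by simp
    have "1 = pi powr (1 - \<alpha>) * pi powr (\<alpha> - 1)" by (simp add: powr_add[symmetric])
    also have "\<dots> \<le> pi powr (1 - \<alpha>) * \<bar>x\<bar> powr (\<alpha> - 1)"
      using x \<alpha> by (intro mult_left_mono powr_mono2') auto
    finally have "L * 1 \<le> L * (pi powr (1 - \<alpha>) * \<bar>x\<bar> powr (\<alpha> - 1))"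
      using L by (intro mult_left_mono)
    moreover have "norm (of_real a * d + e) \<le> a * norm d + norm e"
      using norm_triangle_ineq[of "of_real a * d" e] \<open>0 < a\<close> by (simp add: norm_mult)
    moreover have "a * norm d \<le> a * (c * \<bar>x\<bar> powr (\<alpha> - 1))"
      using d(2) \<open>0 < a\<close> by (intro mult_left_mono) auto
    ultimately have "norm (of_real a * d + e) \<le> c' * \<bar>x\<bar> powr (\<alpha> - 1)"
      using e(2) by (simp add: c'_def algebra_simps)
    then show ?thesis using D by (auto simp: vector_derivative_at intro: differentiableI_vector)
  qed
  moreover have "0 < c'" using ec \<open>0 < a\<close> L by (auto simp: c'_def intro!: add_pos_nonneg)
  ultimately show ?thesis
    unfolding hypI_def fourier_prob[OF G(1)] using G e' by blast
qed

theorem theorem5p1: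
  fixes \<alpha> :: real
  assumes "0 < \<alpha>" and "\<alpha> < 1"
  shows "(\<forall>F. hypI \<alpha> F \<longrightarrow> F \<in> classA) \<and>
         (\<forall>F G a. hypI \<alpha> F \<and> prob_Zplus G \<and> aperiodic G \<and> 0 < a \<and>
            (\<lambda>k. of_int k * \<bar>G k - a * F k\<bar>) summable_on {1..}
            \<longrightarrow> hypI \<alpha> G \<and> G \<in> classA)"
  using hypI_imp_classA[OF assms] hypI_perturb[OF assms] by blast

end
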